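(* Let $\Omega=(a,b)\subset\mathbb{R}$ be a bounded open interval, let $\phi:\mathbb{R}\to\mathbb{R}$ be an odd increasing homeomorphism, and let $f,g:[0,\infty)\to[0,\infty)$ be continuous functions. Let $\mu>0$ and $0\le m,n\in L^1(\Omega)$ with $m\not\equiv0$ and $n\not\equiv0$. Assume that: (F) there exist $c_0,t_0,q>0$ such that $f(t)\ge c_0t^q$ for all $t\in[0,t_0]$ and $\lim_{t\to0^+}\frac{t^q}{\phi(t)}=\infty$; (G1) there exist $c_1,t_1,r_1>0$ such that $g(t)\le c_1t^{r_1}$ for all $t\in[0,t_1]$ and $\lim_{t\to0^+}\frac{t^{r_1}}{\phi(t)}=0$; (G2) there exist $c_2,t_2,r_2>0$ such that $g(t)\ge c_2t^{r_2}$ for all $t\ge t_2$ and $\lim_{t\to\infty}\frac{t^{r_2}}{\phi(t)}=\infty$. Then for all sufficiently small $\lambda>0$ (i.e. there is $\lambda_*>0$ such that for all $0<\lambda<\lambda_*$) the problem $$\begin{cases}-\phi(u')'=\lambda m(x)f(u)+\mu n(x)g(u) & \text{in }\Omega,\\ u=0 & \text{on }\partial\Omega\end{cases}$$ has at least two solutions in $\mathcal{P}^\circ$.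
   Context: $\mathcal{C}_0^1(\overline\Omega):=\{u\in\mathcal{C}^1(\overline\Omega):u=0\text{ on }\partial\Omega\}$ and $$\mathcal{P}^\circ:=\{u\in\mathcal{C}_0^1(\overline\Omega):u>0\text{ in }\Omega\text{ and }u'(b)<0<u'(a)\}.$$ A solution in $\mathcal{P}^\circ$ is a function $u\in\mathcal{P}^\circ$ such that $\phi(u')$ is absolutely continuous on $\overline\Omega$ and the equation holds for a.e. $x\in\Omega$. Inequalities such as $0\le m$ and $m\not\equiv0$ are understood in the a.e. sense. *)

theory Defs
  imports "HOL-Analysis.Analysis"
begin

text \<open>
  Functions on the closed interval are total functions \<open>real \<Rightarrow> real\<close> of which only the values on
  \<open>{a..b}\<close> matter. Derivatives are taken within \<open>{a..b}\<close>, hence are one-sided at the end points.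
\<close>

definition deriv_on :: "real \<Rightarrow> real \<Rightarrow> (real \<Rightarrow> real) \<Rightarrow> real \<Rightarrow> real" where
  "deriv_on a b u x = vector_derivative u (at x within {a..b})"

definition C1_0 :: "real \<Rightarrow> real \<Rightarrow> (real \<Rightarrow> real) set" where
  "C1_0 a b = {u. u differentiable_on {a..b} \<and> continuous_on {a..b} (deriv_on a b u) \<and>
                  u a = 0 \<and> u b = 0}"

definition P_circ :: "real \<Rightarrow> real \<Rightarrow> (real \<Rightarrow> real) set" where
  "P_circ a b = {u \<in> C1_0 a b. (\<forall>x\<in>{a<..<b}. u x > 0) \<and>
                  deriv_on a b u b < 0 \<and> 0 < deriv_on a b u a}"

text \<open>
  Absolute continuity of a function on a compact interval; the library's
  \<^const>\<open>absolutely_continuous\<close> is the unrelated notion for measures.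
\<close>

definition abs_cont_on :: "real \<Rightarrow> real \<Rightarrow> (real \<Rightarrow> real) \<Rightarrow> bool" where
  "abs_cont_on a b h \<longleftrightarrow>
     (\<forall>\<epsilon>>0. \<exists>\<delta>>0. \<forall>(k::nat) s t.
        (\<forall>i<k. a \<le> s i \<and> s i \<le> t i \<and> t i \<le> b) \<and>
        disjoint_family_on (\<lambda>i. {s i<..<t i}) {..<k} \<and>
        (\<Sum>i<k. t i - s i) < \<delta>
        \<longrightarrow> (\<Sum>i<k. \<bar>h (t i) - h (s i)\<bar>) < \<epsilon>)"

text \<open>
  Solutions in \<open>P_circ a b\<close> of \<open>- \<phi>(u')' = F(x, u)\<close> in \<open>(a, b)\<close>, \<open>u(a) = u(b) = 0\<close>;
  the boundary condition is part of \<open>P_circ\<close>.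
\<close>

definition solution_in_P_circ ::
    "real \<Rightarrow> real \<Rightarrow> (real \<Rightarrow> real) \<Rightarrow> (real \<Rightarrow> real \<Rightarrow> real) \<Rightarrow> (real \<Rightarrow> real) \<Rightarrow> bool" where
  "solution_in_P_circ a b \<phi> F u \<longleftrightarrow>
     u \<in> P_circ a b \<and>
     abs_cont_on a b (\<lambda>x. \<phi> (deriv_on a b u x)) \<and>
     (AE x\<in>{a<..<b} in lebesgue.
        \<exists>d. ((\<lambda>y. \<phi> (deriv_on a b u y)) has_real_derivative d) (at x) \<and> - d = F x (u x))"

end

theory Submission
  imports Defs "HOL-Complex_Analysis.Great_Picard"
begin

text \<open>
  The proof is by shooting from \<open>a\<close>. Let \<open>\<psi>\<close> be the inverse of \<open>\<phi>\<close>. Solutions of the initial value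
  problem with \<open>\<phi>(u'(a)) = s > 0\<close> are the fixed points of an integral operator; as the right-hand
  side is nonnegative, they are concave. A concave solution with \<open>u(b) = 0\<close> automatically
  lies in \<open>P_circ\<close>, so two values of \<open>s\<close> with \<open>u(b) = 0\<close> are needed. They come from two sign changes
  of \<open>u(b)\<close>.

  For medium \<open>s\<close>, the flux \<open>\<phi>(u')\<close> stays positive and \<open>u(b) > 0\<close>: by (G1) the term with \<open>g\<close> is small
  compared with \<open>s\<close> if the initial slope is a suitable \<open>\<sigma>\<close>, and so is the term with \<open>f\<close>
  once \<open>\<lambda>\<close> is small. For small \<open>s\<close> and for large \<open>s\<close>, \<open>u(b) < 0\<close>: if \<open>u(b) \<ge> 0\<close>, then
  on an inner interval \<open>u\<close> is at least a fixed fraction of its maximum \<open>U\<close> by concavity, so the flux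
  drops there by at least a constant times \<open>U powr q\<close> (respectively \<open>U powr r\<^sub>2\<close>); but slopes in this
  interval are at most a constant times \<open>U\<close>, so the drop is at most \<open>2 * \<phi> (U / d)\<close>. By (F) this is
  impossible for small \<open>U\<close>, and by (G2) for large \<open>U\<close>
  (lemmas \<open>exact_flux_drop\<close> and \<open>exact_power_drop\<close>).

  Initial value problems need not have unique solutions here, so \<open>u(b)\<close> is not a function of \<open>s\<close>.
  Delaying the argument \<open>u\<close> on the right-hand side by \<open>d > 0\<close> restores uniqueness and continuous
  dependence; the intermediate value theorem applies, and letting \<open>d\<close> tend to zero preserves the zero
  of \<open>u(b)\<close> by compactness (theorem \<open>exact_zero_between\<close>).

  Two facts on real functions are proved for the regularity of the solutions: an indefinite
  integral is absolutely continuous, and it is differentiable almost everywhere with the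
  integrand as its derivative.
\<close>

section \<open>Differentiation of indefinite integrals\<close>

text \<open>
  For a fixed tolerance, every exceptional point is an end point of arbitrarily short intervals on
  which the mean of \<open>h\<close> is off by more than \<open>\<epsilon>\<close>. Such intervals can be chosen inside a gauge that
  makes the Riemann error small, and the Vitali covering lemma extracts disjoint ones whose
  fivefold enlargements still cover. Disjointness makes them a tagged partial division, so the
  Henstock lemma bounds \<open>\<epsilon>\<close> times their total length by the Riemann error.
\<close>

lemma indefinite_integral_derivative_exceptional_null:
  fixes h :: "real \<Rightarrow> real" and a b \<epsilon> :: real
  assumes h: "h integrable_on {a..b}" and "\<epsilon> > 0"
  defines "J \<equiv> \<lambda>p q. integral {p..q} h"
  shows "negligible {x \<in> {a<..<b}. \<forall>\<delta>>0. \<exists>p q. a \<le> p \<and> p < q \<and> q \<le> b \<and> (x = p \<or> x = q) \<and>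
            q - p < \<delta> \<and> \<bar>(q - p) * h x - J p q\<bar> > \<epsilon> * (q - p)}" (is "negligible ?E")
  unfolding negligible_outer_le
proof (intro allI impI)
  fix e :: real assume "e > 0"
  then have e5: "\<epsilon> * e / 5 > 0" using \<open>\<epsilon> > 0\<close> by simp
  have "h integrable_on cbox a b" using h by simp
  then obtain \<gamma> where "gauge \<gamma>" and hen: "\<And>p. \<lbrakk>p tagged_partial_division_of (cbox a b); \<gamma> fine p\<rbrakk> \<Longrightarrow>
             sum (\<lambda>(x,k). norm(measure lborel k *\<^sub>R h x - integral k h)) p < \<epsilon> * e / 5"
    by (rule Henstock_lemma[OF _ e5]) blast
  \<comment> \<open>Bad intervals, as triples of tag, midpoint and half length.\<close>
  define K where "K = {(x::real,c::real,r::real). 0 < r \<and> a \<le> c - r \<and> c + r \<le> b \<and> (x = c - r \<or> x = c + r)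
     \<and> {c-r..c+r} \<subseteq> \<gamma> x \<and> \<bar>(2*r) * h x - J (c-r) (c+r)\<bar> > \<epsilon> * (2*r)}"
  have cov: "?E \<subseteq> (\<Union>i\<in>K. cball (fst (snd i)) (snd (snd i)))"
  proof
    fix x assume x: "x \<in> ?E"
    have "open (\<gamma> x)" "x \<in> \<gamma> x" using \<open>gauge \<gamma>\<close> unfolding gauge_def by auto
    then obtain \<delta> where "\<delta> > 0" and ball: "ball x \<delta> \<subseteq> \<gamma> x" using open_contains_ball by blast
    then obtain p q where pq: "a \<le> p" "p < q" "q \<le> b" "x = p \<or> x = q" "q - p < \<delta>"
      "\<bar>(q - p) * h x - J p q\<bar> > \<epsilon> * (q - p)" using x by blast
    have "{p..q} \<subseteq> ball x \<delta>" using pq by (auto simp: dist_real_def)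
    then have sub: "{p..q} \<subseteq> \<gamma> x" using ball by blast
    have ends: "(p+q)/2 - (q-p)/2 = p" "(p+q)/2 + (q-p)/2 = q" "2 * ((q-p)/2) = q - p"
      by (simp_all add: field_simps)
    have "(x, (p+q)/2, (q-p)/2) \<in> K"
      unfolding K_def using pq sub by (simp only: mem_Collect_eq case_prod_conv ends) simp
    moreover have "x \<in> cball ((p+q)/2) ((q-p)/2)"
      unfolding cball_eq_atLeastAtMost ends using pq by auto
    ultimately show "x \<in> (\<Union>i\<in>K. cball (fst (snd i)) (snd (snd i)))" by force
  qed
  have rb: "\<And>i. i \<in> K \<Longrightarrow> 0 < snd (snd i) \<and> snd (snd i) \<le> b - a" by (auto simp: K_def)
  obtain C where C: "countable C" "C \<subseteq> K"
     and dis: "pairwise (\<lambda>i j. disjnt (cball (fst (snd i)) (snd (snd i))) (cball (fst (snd j)) (snd (snd j)))) C"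
     and covC: "?E \<subseteq> (\<Union>i\<in>C. cball (fst (snd i)) (5 * snd (snd i)))"
    by (rule Vitali_covering_lemma_cballs[OF cov rb]) blast+
  let ?I = "\<lambda>i. cball (fst (snd i)) (snd (snd i)) :: real set"
  have fin: "10 * (\<Sum>i\<in>D. snd (snd i)) \<le> e" if D: "D \<subseteq> C" "finite D" for D
  proof -
    have inj: "inj_on (\<lambda>i. (fst i, ?I i)) D"
    proof (rule inj_onI)
      fix i j assume ij: "i \<in> D" "j \<in> D" "(fst i, ?I i) = (fst j, ?I j)"
      show "i = j"
      proof (rule ccontr)
        assume "i \<noteq> j"
        moreover have "i \<in> C" "j \<in> C" using ij D by auto
        ultimately have "disjnt (?I i) (?I j)" using pairwiseD[OF dis] by blast
        moreover have "?I i = ?I j" "fst (snd i) \<in> ?I i" using ij rb[of i] C D by force+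
        ultimately show False unfolding disjnt_def by blast
      qed
    qed
    let ?p = "(\<lambda>i. (fst i, ?I i)) ` D"
    have tag: "?p tagged_partial_division_of cbox a b"
      unfolding tagged_partial_division_of_def
    proof (intro conjI allI impI)
      show "finite ?p" using D by simp
    next
      fix x k assume "(x,k) \<in> ?p"
      then obtain i where i: "i \<in> D" "x = fst i" "k = ?I i" by blast
      then have "i \<in> K" using D C by blast
      then show "x \<in> k" "k \<subseteq> cbox a b" "\<exists>a b. k = cbox a b" using i
        by (auto simp: K_def dist_real_def cball_eq_atLeastAtMost)
    next
      fix x1 K1 x2 K2 assume "(x1,K1) \<in> ?p \<and> (x2,K2) \<in> ?p \<and> (x1,K1) \<noteq> (x2,K2)"
      then obtain i j where ij: "i \<in> D" "j \<in> D" "i \<noteq> j" "K1 = ?I i" "K2 = ?I j" by blast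
      then have "K1 \<inter> K2 = {}" using dis D by (auto simp: pairwise_def disjnt_def)
      then show "interior K1 \<inter> interior K2 = {}" using interior_subset by blast
    qed
    have fine: "\<gamma> fine ?p"
    proof (rule fineI)
      fix x k assume "(x,k) \<in> ?p"
      then obtain i where i: "i \<in> D" "x = fst i" "k = ?I i" by blast
      then have "i \<in> K" using D C by blast
      then show "k \<subseteq> \<gamma> x" using i by (auto simp: K_def cball_eq_atLeastAtMost)
    qed
    have "(\<Sum>i\<in>D. \<epsilon> * (2 * snd (snd i))) \<le> (\<Sum>i\<in>D. norm (measure lborel (?I i) *\<^sub>R h (fst i) - integral (?I i) h))"
    proof (rule sum_mono)
      fix i assume "i \<in> D"
      then have "i \<in> K" using D C by blast
      then show "\<epsilon> * (2 * snd (snd i)) \<le> norm (measure lborel (?I i) *\<^sub>R h (fst i) - integral (?I i) h)"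
        by (auto simp: K_def cball_eq_atLeastAtMost J_def)
    qed
    also have "\<dots> = sum (\<lambda>(x,k). norm(measure lborel k *\<^sub>R h x - integral k h)) ?p"
      by (subst sum.reindex[OF inj]) (simp add: o_def)
    also have "\<dots> < \<epsilon> * e / 5" using hen[OF tag fine] .
    finally have "\<epsilon> * (10 * (\<Sum>i\<in>D. snd (snd i))) \<le> \<epsilon> * e"
      by (simp add: sum_distrib_left[symmetric] field_simps)
    then show ?thesis using \<open>\<epsilon> > 0\<close> by simp
  qed
  let ?T = "\<Union>i\<in>C. cball (fst (snd i)) (5 * snd (snd i)) :: real set"
  have bd: "measure lebesgue (\<Union>i\<in>D. cball (fst (snd i)) (5 * snd (snd i)) :: real set) \<le> e"
    if D: "D \<subseteq> C" "finite D" for D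
  proof -
    have "measure lebesgue (\<Union>i\<in>D. cball (fst (snd i)) (5 * snd (snd i)) :: real set)
      \<le> (\<Sum>i\<in>D. measure lebesgue (cball (fst (snd i)) (5 * snd (snd i)) :: real set))"
      by (rule measure_UNION_le) (use D in auto)
    also have "\<dots> = (\<Sum>i\<in>D. 10 * snd (snd i))"
      by (rule sum.cong) (use D C rb in \<open>auto simp: cball_eq_atLeastAtMost less_imp_le\<close>)
    also have "\<dots> \<le> e" using fin[OF D] by (simp add: sum_distrib_left)
    finally show ?thesis .
  qed
  have "?T \<in> lmeasurable" "measure lebesgue ?T \<le> e"
    using fmeasurable_UN_bound[of C "\<lambda>i. cball (fst (snd i)) (5 * snd (snd i))" lebesgue e]
      measure_UN_bound[of C "\<lambda>i. cball (fst (snd i)) (5 * snd (snd i))" lebesgue e] C bd by auto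
  then show "\<exists>T. ?E \<subseteq> T \<and> T \<in> lmeasurable \<and> measure lebesgue T \<le> e" using covC by blast
qed

text \<open>
  The Lebesgue differentiation theorem on the line: off the union of the exceptional sets with
  tolerances \<open>1 / Suc k\<close>, the difference quotients of the indefinite integral converge.
\<close>

lemma AE_has_derivative_indefinite_integral:
  fixes h :: "real \<Rightarrow> real" and a b :: real
  assumes h: "h integrable_on {a..b}"
  shows "AE x\<in>{a<..<b} in lebesgue. ((\<lambda>x. integral {a..x} h) has_real_derivative h x) (at x)"
proof -
  let ?J = "\<lambda>p q. integral {p..q} h"
  define E where "E k = {x \<in> {a<..<b}. \<forall>\<delta>>0. \<exists>p q. a \<le> p \<and> p < q \<and> q \<le> b \<and> (x = p \<or> x = q) \<and>
            q - p < \<delta> \<and> \<bar>(q - p) * h x - ?J p q\<bar> > 1 / real (Suc k) * (q - p)}" for k :: nat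
  have "negligible (\<Union>k. E k)"
    unfolding E_def
    by (rule negligible_Union_nat, rule indefinite_integral_derivative_exceptional_null[OF h]) simp
  then have null: "(\<Union>k. E k) \<in> null_sets lebesgue" by (simp add: negligible_iff_null_sets)
  show ?thesis
  proof (rule AE_I'[OF null], rule subsetI, rule ccontr)
    fix x assume x: "x \<in> {x \<in> space lebesgue. \<not> (x \<in> {a<..<b} \<longrightarrow> (?J a has_real_derivative h x) (at x))}"
      and nE: "x \<notin> (\<Union>k. E k)"
    from x have x1: "a < x" "x < b" and x2: "\<not> (?J a has_real_derivative h x) (at x)" by auto
    have "(?J a has_real_derivative h x) (at x)"
      unfolding has_field_derivative_def has_derivative_at_alt
    proof (intro conjI allI impI)
      show "bounded_linear ((*) (h x))" by (rule bounded_linear_mult_right)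
      fix e :: real assume "e > 0"
      then obtain k where k: "1 / real (Suc k) < e" using nat_approx_posE by blast
      have "x \<notin> E k" using nE by blast
      then have "\<exists>\<delta>>0. \<forall>p q. \<not> (a \<le> p \<and> p < q \<and> q \<le> b \<and> (x = p \<or> x = q) \<and>
            q - p < \<delta> \<and> \<bar>(q - p) * h x - ?J p q\<bar> > 1 / real (Suc k) * (q - p))"
        unfolding E_def using x1 by (simp only: mem_Collect_eq greaterThanLessThan_iff) blast
      then obtain \<delta> where \<delta>: "\<delta> > 0" and d: "\<And>p q. a \<le> p \<Longrightarrow> p < q \<Longrightarrow> q \<le> b \<Longrightarrow> (x = p \<or> x = q) \<Longrightarrow>
            q - p < \<delta> \<Longrightarrow> \<bar>(q - p) * h x - ?J p q\<bar> \<le> 1 / real (Suc k) * (q - p)"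
        by (meson not_less)
      have comb: "?J a q - ?J a p = ?J p q" if "a \<le> p" "p \<le> q" "q \<le> b" for p q
      proof -
        have "h integrable_on {a..q}" by (rule integrable_on_subinterval[OF h]) (use that in auto)
        from Henstock_Kurzweil_Integration.integral_combine[OF that(1,2) this] show ?thesis by simp
      qed
      show "\<exists>d>0. \<forall>y. norm (y - x) < d \<longrightarrow> norm (?J a y - ?J a x - h x * (y - x)) \<le> e * norm (y - x)"
      proof (intro exI[of _ "min \<delta> (min (x - a) (b - x))"] conjI allI impI)
        show "0 < min \<delta> (min (x - a) (b - x))" using \<delta> x1 by simp
        fix y assume y: "norm (y - x) < min \<delta> (min (x - a) (b - x))"
        have ye: "1 / real (Suc k) * \<bar>y - x\<bar> \<le> e * \<bar>y - x\<bar>" using k by (intro mult_right_mono) auto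
        consider "y = x" | "x < y" | "y < x" by linarith
        then show "norm (?J a y - ?J a x - h x * (y - x)) \<le> e * norm (y - x)"
        proof cases
          case 2
          have "\<bar>(y - x) * h x - ?J x y\<bar> \<le> 1 / real (Suc k) * (y - x)"
            by (rule d) (use 2 y x1 in auto)
          moreover have "?J a y - ?J a x = ?J x y" by (rule comb) (use 2 y x1 in auto)
          ultimately show ?thesis using 2 ye by (simp add: abs_minus_commute mult.commute)
        next
          case 3
          have "\<bar>(x - y) * h x - ?J y x\<bar> \<le> 1 / real (Suc k) * (x - y)"
            by (rule d) (use 3 y x1 in auto)
          moreover have "?J a x - ?J a y = ?J y x" by (rule comb) (use 3 y x1 in auto)
          moreover have "?J a y - ?J a x - h x * (y - x) = (x - y) * h x - (?J a x - ?J a y)"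
            by (simp add: algebra_simps)
          ultimately show ?thesis using 3 ye by simp
        qed simp
      qed
    qed
    then show False using x2 by blast
  qed
qed

section \<open>Absolute continuity of indefinite integrals\<close>

text \<open>
  The truncations of \<open>h\<close> at integer heights converge to \<open>h\<close> pointwise and are dominated by it.
\<close>

lemma integral_truncation_small:
  fixes h :: "real \<Rightarrow> real"
  assumes S: "S \<in> sets lebesgue" and h: "h integrable_on S"
    and pos: "\<And>x. x \<in> S \<Longrightarrow> 0 \<le> h x" and "e > 0"
  obtains K where "K > 0" "(\<lambda>x. h x - min (h x) K) integrable_on S" "integral S (\<lambda>x. h x - min (h x) K) < e"
proof -
  define T where "T k x = h x - min (h x) (real (Suc k))" for k x
  have meas: "h \<in> borel_measurable (lebesgue_on S)"
    using integrable_imp_measurable h by blast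
  have int: "T k integrable_on S" for k
  proof (rule measurable_bounded_by_integrable_imp_integrable[OF _ h])
    show "T k \<in> borel_measurable (lebesgue_on S)" unfolding T_def using meas by measurable
    show "S \<in> sets lebesgue" by (rule S)
  qed (use pos in \<open>auto simp: T_def min_def\<close>)
  have "(\<lambda>k. integral S (T k)) \<longlonglongrightarrow> integral S (\<lambda>x. 0)"
  proof (rule dominated_convergence(2)[OF int h])
    show "norm (T k x) \<le> h x" if "x \<in> S" for k x using pos[OF that] by (auto simp: T_def min_def)
    show "(\<lambda>k. T k x) \<longlonglongrightarrow> 0" for x
    proof (rule tendsto_eventually)
      obtain N where "h x < real N" using reals_Archimedean2 by blast
      then show "\<forall>\<^sub>F k in sequentially. T k x = 0"
        unfolding eventually_sequentially by (intro exI[of _ N]) (auto simp: T_def)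
    qed
  qed
  then have "\<forall>\<^sub>F k in sequentially. integral S (T k) < e" using \<open>e > 0\<close> by (simp add: order_tendstoD)
  then obtain k where "integral S (T k) < e" by (meson eventually_sequentially order_refl)
  with int[of k] show ?thesis by (intro that[of "real (Suc k)"]) (auto simp: T_def[abs_def])
qed

text \<open>
  Over disjoint intervals of total length \<open>\<delta>\<close>, the part of \<open>h\<close> below the height \<open>K\<close> contributes at
  most \<open>K * \<delta>\<close>, and the part above it at most its whole integral, which is small for large \<open>K\<close>.
\<close>

lemma abs_cont_on_indefinite_integral:
  fixes h :: "real \<Rightarrow> real"
  assumes h: "h integrable_on {a..b}" and pos: "\<And>x. x \<in> {a..b} \<Longrightarrow> 0 \<le> h x"
    and W: "\<And>x. x \<in> {a..b} \<Longrightarrow> W x = c - integral {a..x} h"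
  shows "abs_cont_on a b W"
  unfolding abs_cont_on_def
proof (intro allI impI)
  fix e :: real assume "e > 0"
  then obtain K where K: "K > 0" "(\<lambda>x. h x - min (h x) K) integrable_on {a..b}"
      "integral {a..b} (\<lambda>x. h x - min (h x) K) < e/2"
    using integral_truncation_small[OF _ h pos, of "e/2"] by force
  let ?T = "\<lambda>x. h x - min (h x) K"
  show "\<exists>\<delta>>0. \<forall>(k::nat) s t.
        (\<forall>i<k. a \<le> s i \<and> s i \<le> t i \<and> t i \<le> b) \<and>
        disjoint_family_on (\<lambda>i. {s i<..<t i}) {..<k} \<and>
        (\<Sum>i<k. t i - s i) < \<delta>
        \<longrightarrow> (\<Sum>i<k. \<bar>W (t i) - W (s i)\<bar>) < e"
  proof (intro exI[of _ "e / (2*K)"] conjI allI impI)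
    show "0 < e / (2*K)" using \<open>e > 0\<close> K by simp
    fix k :: nat and s t :: "nat \<Rightarrow> real"
    assume A: "(\<forall>i<k. a \<le> s i \<and> s i \<le> t i \<and> t i \<le> b) \<and>
        disjoint_family_on (\<lambda>i. {s i<..<t i}) {..<k} \<and> (\<Sum>i<k. t i - s i) < e / (2*K)"
    have each: "\<bar>W (t i) - W (s i)\<bar> \<le> K * (t i - s i) + integral {s i<..<t i} ?T" if "i < k" for i
    proof -
      have st: "a \<le> s i" "s i \<le> t i" "t i \<le> b" using A that by auto
      have ih: "h integrable_on {p..q}" if "a \<le> p" "q \<le> b" for p q
        by (rule integrable_on_subinterval[OF h]) (use that in auto)
      have iT: "?T integrable_on {s i..t i}"
        by (rule integrable_on_subinterval[OF K(2)]) (use st in auto)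
      have eq: "W (t i) - W (s i) = - integral {s i..t i} h"
        using Henstock_Kurzweil_Integration.integral_combine[OF st(1,2) ih[OF order_refl st(3)]] st by (simp add: W)
      have nn: "0 \<le> integral {s i..t i} h"
        by (rule integral_nonneg[OF ih[OF st(1,3)]]) (use st pos in auto)
      have "integral {s i..t i} h \<le> integral {s i..t i} (\<lambda>x. K + ?T x)"
        by (rule integral_le[OF ih[OF st(1,3)]]) (use iT in \<open>auto intro!: integrable_add\<close>)
      also have "\<dots> = integral {s i..t i} (\<lambda>x. K) + integral {s i..t i} ?T"
        by (rule integral_add[OF _ iT]) auto
      also have "\<dots> = K * (t i - s i) + integral {s i<..<t i} ?T"
        using st by (simp add: integral_open_interval_real)
      finally show ?thesis using eq nn by simp
    qed
    have U: "(?T has_integral (\<Sum>i<k. integral {s i<..<t i} ?T)) (\<Union>i\<in>{..<k}. {s i<..<t i})"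
    proof (rule has_integral_UN)
      show "(?T has_integral integral {s i<..<t i} ?T) {s i<..<t i}" if "i \<in> {..<k}" for i
      proof -
        have "?T integrable_on {s i..t i}"
          by (rule integrable_on_subinterval[OF K(2)]) (use A that in auto)
        then show ?thesis using integrable_on_Icc_iff_Ioo integrable_integral by blast
      qed
      show "pairwise (\<lambda>i j. negligible ({s i<..<t i} \<inter> {s j<..<t j})) {..<k}"
        using A by (auto simp: pairwise_def disjoint_family_on_def)
    qed simp
    have "(\<Sum>i<k. integral {s i<..<t i} ?T) = integral (\<Union>i\<in>{..<k}. {s i<..<t i}) ?T"
      using U by (simp add: integral_unique)
    also have "\<dots> \<le> integral {a..b} ?T"
    proof (rule integral_subset_le)
      show "(\<Union>i<k. {s i<..<t i}) \<subseteq> {a..b}" using A by force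
    qed (use U K in \<open>auto simp: has_integral_integrable\<close>)
    finally have T: "(\<Sum>i<k. integral {s i<..<t i} ?T) < e/2" using K by simp
    have "(\<Sum>i<k. \<bar>W (t i) - W (s i)\<bar>) \<le> (\<Sum>i<k. K * (t i - s i) + integral {s i<..<t i} ?T)"
      by (rule sum_mono) (use each in auto)
    also have "\<dots> = K * (\<Sum>i<k. t i - s i) + (\<Sum>i<k. integral {s i<..<t i} ?T)"
      by (simp add: sum.distrib sum_distrib_left)
    also have "K * (\<Sum>i<k. t i - s i) < K * (e / (2*K))" using A K by (intro mult_strict_left_mono) auto
    also have "K * (e / (2*K)) = e/2" using K by simp
    finally show "(\<Sum>i<k. \<bar>W (t i) - W (s i)\<bar>) < e" using T by simp
  qed
qed

section \<open>Trajectories of the initial value problem\<close>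

text \<open>
  Data of the initial value problem \<open>- \<phi>(u')' = F(x, u)\<close>, \<open>u(a) = 0\<close>, \<open>\<phi>(u'(a)) = s\<close>, where
  \<open>\<psi>\<close> stands for the inverse of \<open>\<phi>\<close>. The domination of \<open>F\<close> is required for all \<open>u\<close> below \<open>R\<close>, also
  very negative ones: trajectories have an obvious upper bound, whereas a lower bound would depend
  on the integral of \<open>F\<close> itself.
\<close>

locale shooting =
  fixes a b :: real and \<psi> :: "real \<Rightarrow> real" and F :: "real \<Rightarrow> real \<Rightarrow> real"
  assumes ab: "a < b"
    and psi_cont: "continuous_on UNIV \<psi>" and psi_mono: "strict_mono \<psi>" and psi_0: "\<psi> 0 = 0"
    and F_int: "\<And>v. continuous_on {a..b} v \<Longrightarrow> (\<lambda>z. F z (v z)) integrable_on {a..b}"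
    and F_nonneg: "\<And>z u. 0 \<le> F z u"
    and F_bound: "\<And>R. \<exists>h. h integrable_on {a..b} \<and> (\<forall>z\<in>{a..b}. \<forall>u\<le>R. F z u \<le> h z)"
    and F_cont: "\<And>z. continuous_on UNIV (F z)"
begin

text \<open>
  Two integrations turn the problem into the fixed point equation \<open>u = traj s u\<close>, in which
  \<open>flux s u\<close> is \<open>\<phi>(u')\<close>.
\<close>

definition flux :: "real \<Rightarrow> (real \<Rightarrow> real) \<Rightarrow> real \<Rightarrow> real" where
  "flux s v y = s - integral {a..y} (\<lambda>z. F z (v z))"

definition traj :: "real \<Rightarrow> (real \<Rightarrow> real) \<Rightarrow> real \<Rightarrow> real" where
  "traj s v x = integral {a..x} (\<lambda>y. \<psi> (flux s v y))"

text \<open>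
  Exact as opposed to delayed, see below. Since \<open>\<psi>\<close> and \<open>F z\<close> are merely continuous, there may
  be several exact trajectories for one \<open>s\<close>.
\<close>

definition exact :: "real \<Rightarrow> (real \<Rightarrow> real) \<Rightarrow> bool" where
  "exact s u \<longleftrightarrow> continuous_on {a..b} u \<and> (\<forall>x\<in>{a..b}. u x = traj s u x)"

lemma psi_le: "x \<le> y \<Longrightarrow> \<psi> x \<le> \<psi> y"
  using psi_mono by (simp add: strict_mono_less_eq)

lemma F_int_sub: "continuous_on {a..b} v \<Longrightarrow> a \<le> p \<Longrightarrow> q \<le> b \<Longrightarrow> (\<lambda>z. F z (v z)) integrable_on {p..q}"
  by (rule integrable_on_subinterval[OF F_int]) auto

lemma flux_start [simp]: "flux s v a = s" by (simp add: flux_def)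

lemma traj_start [simp]: "traj s v a = 0" by (simp add: traj_def)

lemma flux_diff:
  assumes "continuous_on {a..b} v" "a \<le> x" "x \<le> y" "y \<le> b"
  shows "flux s v x - flux s v y = integral {x..y} (\<lambda>z. F z (v z))"
  using Henstock_Kurzweil_Integration.integral_combine[OF assms(2,3) F_int_sub[OF assms(1) order_refl assms(4)]]
  by (simp add: flux_def)

lemma flux_antimono:
  assumes "continuous_on {a..b} v" "a \<le> x" "x \<le> y" "y \<le> b"
  shows "flux s v y \<le> flux s v x"
proof -
  have "0 \<le> integral {x..y} (\<lambda>z. F z (v z))"
    by (rule integral_nonneg[OF F_int_sub]) (use assms F_nonneg in auto)
  with flux_diff[OF assms] show ?thesis by (simp add: algebra_simps)
qed

lemma flux_le: "continuous_on {a..b} v \<Longrightarrow> a \<le> y \<Longrightarrow> y \<le> b \<Longrightarrow> flux s v y \<le> s"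
  using flux_antimono[of v a y s] by simp

lemma flux_cont: "continuous_on {a..b} v \<Longrightarrow> continuous_on {a..b} (flux s v)"
  unfolding flux_def[abs_def]
  by (intro continuous_intros indefinite_integral_continuous_1 F_int)

lemma slope_cont: "continuous_on {a..b} v \<Longrightarrow> continuous_on {a..b} (\<lambda>y. \<psi> (flux s v y))"
  by (rule continuous_on_compose2[OF psi_cont flux_cont]) auto

lemma slope_int: "continuous_on {a..b} v \<Longrightarrow> a \<le> p \<Longrightarrow> q \<le> b \<Longrightarrow> (\<lambda>y. \<psi> (flux s v y)) integrable_on {p..q}"
  by (rule integrable_continuous_real, rule continuous_on_subset[OF slope_cont]) auto

lemma traj_diff:
  assumes "continuous_on {a..b} v" "a \<le> x" "x \<le> y" "y \<le> b"
  shows "traj s v y - traj s v x = integral {x..y} (\<lambda>z. \<psi> (flux s v z))"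
  using Henstock_Kurzweil_Integration.integral_combine[OF assms(2,3) slope_int[OF assms(1) order_refl assms(4)], of s]
  by (simp add: traj_def)

lemma traj_deriv:
  assumes "continuous_on {a..b} v" "x \<in> {a..b}"
  shows "(traj s v has_real_derivative \<psi> (flux s v x)) (at x within {a..b})"
  unfolding traj_def[abs_def]
  by (rule integral_has_real_derivative[OF slope_cont[OF assms(1)] assms(2)])

lemma traj_cont: "continuous_on {a..b} v \<Longrightarrow> continuous_on {a..b} (traj s v)"
  by (rule DERIV_continuous_on[OF traj_deriv])

lemma traj_le:
  assumes "continuous_on {a..b} v" "x \<in> {a..b}" "s \<le> S"
  shows "traj s v x \<le> (b - a) * max 0 (\<psi> S)"
proof -
  have "traj s v x \<le> integral {a..x} (\<lambda>y. max 0 (\<psi> S))"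
    unfolding traj_def
  proof (rule integral_le[OF slope_int])
    fix y assume "y \<in> {a..x}"
    then have "flux s v y \<le> S" using flux_le[of v y s] assms by auto
    then show "\<psi> (flux s v y) \<le> max 0 (\<psi> S)" using psi_le by (simp add: le_max_iff_disj)
  qed (use assms in auto)
  also have "\<dots> \<le> (b - a) * max 0 (\<psi> S)" using assms by (auto intro: mult_right_mono)
  finally show ?thesis .
qed

text \<open>
  Concavity: the slope \<open>\<psi> (flux s v y)\<close> decreases in \<open>y\<close>, so the graph lies below its tangents.
\<close>

lemma tangent:
  assumes v: "continuous_on {a..b} v" and y: "y \<in> {a..b}" and z: "z \<in> {a..b}"
  shows "traj s v z \<le> traj s v y + \<psi> (flux s v y) * (z - y)"
proof (cases "y \<le> z")
  case True
  have "traj s v z - traj s v y = integral {y..z} (\<lambda>t. \<psi> (flux s v t))"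
    by (rule traj_diff[OF v]) (use True y z in auto)
  also have "\<dots> \<le> integral {y..z} (\<lambda>t. \<psi> (flux s v y))"
    by (rule integral_le[OF slope_int[OF v]]) (use y z in \<open>auto intro!: psi_le flux_antimono[OF v]\<close>)
  also have "\<dots> = \<psi> (flux s v y) * (z - y)" using True by simp
  finally show ?thesis by simp
next
  case False
  have "\<psi> (flux s v y) * (y - z) = integral {z..y} (\<lambda>t. \<psi> (flux s v y))" using False by simp
  also have "\<dots> \<le> integral {z..y} (\<lambda>t. \<psi> (flux s v t))"
    by (rule integral_le[OF _ slope_int[OF v]]) (use y z in \<open>auto intro!: psi_le flux_antimono[OF v]\<close>)
  also have "\<dots> = traj s v y - traj s v z"
    by (rule traj_diff[OF v, symmetric]) (use False y z in auto)
  finally show ?thesis by (simp add: algebra_simps)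
qed

text \<open>
  The bound is uniform in the start value and the argument; it serves as a dominating constant and
  as a common Lipschitz constant.
\<close>

lemma slope_bounded:
  obtains K where "K > 0"
    "\<And>s v y. s \<in> {lo..hi} \<Longrightarrow> continuous_on {a..b} v \<Longrightarrow> (\<And>z. z \<in> {a..b} \<Longrightarrow> v z \<le> R) \<Longrightarrow>
       y \<in> {a..b} \<Longrightarrow> \<bar>\<psi> (flux s v y)\<bar> \<le> K"
proof -
  obtain h where h: "h integrable_on {a..b}" "\<And>z u. z\<in>{a..b} \<Longrightarrow> u \<le> R \<Longrightarrow> F z u \<le> h z"
    using F_bound[of R] by blast
  let ?C = "integral {a..b} h"
  show ?thesis
  proof (rule that)
    show "0 < max 1 (max \<bar>\<psi> (lo - ?C)\<bar> \<bar>\<psi> hi\<bar>)" by simp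
    fix s v y assume s: "s \<in> {lo..hi}" and v: "continuous_on {a..b} v"
      and R: "\<And>z. z \<in> {a..b} \<Longrightarrow> v z \<le> R" and y: "y \<in> {a..b}"
    have "integral {a..y} (\<lambda>z. F z (v z)) \<le> integral {a..b} (\<lambda>z. F z (v z))"
      by (rule integral_subset_le) (use y F_int_sub[OF v] F_nonneg in auto)
    also have "\<dots> \<le> ?C" by (rule integral_le[OF F_int[OF v] h(1)]) (use h R in auto)
    finally have "lo - ?C \<le> flux s v y" using s by (simp add: flux_def)
    then have 1: "\<psi> (lo - ?C) \<le> \<psi> (flux s v y)" by (rule psi_le)
    have "flux s v y \<le> hi" using flux_le[OF v, of y s] y s by auto
    then have 2: "\<psi> (flux s v y) \<le> \<psi> hi" by (rule psi_le)
    from 1 2 show "\<bar>\<psi> (flux s v y)\<bar> \<le> max 1 (max \<bar>\<psi> (lo - ?C)\<bar> \<bar>\<psi> hi\<bar>)" by linarith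
  qed
qed

text \<open>
  Dominated convergence, once for the flux and once for the slope. Pointwise convergence of the
  arguments is enough, so the same lemma gives continuity in the start value and the passage to the
  limit of vanishing delay.
\<close>

lemma traj_continuous_dependence:
  assumes s: "\<sigma> \<longlonglongrightarrow> s" "\<And>j. \<sigma> j \<in> {lo..hi}"
    and vj: "\<And>j. continuous_on {a..b} (v j)" and w: "continuous_on {a..b} w"
    and R: "\<And>j z. z \<in> {a..b} \<Longrightarrow> v j z \<le> R"
    and lim: "\<And>z. z \<in> {a..b} \<Longrightarrow> (\<lambda>j. v j z) \<longlonglongrightarrow> w z"
    and x: "x \<in> {a..b}"
  shows "(\<lambda>j. traj (\<sigma> j) (v j) x) \<longlonglongrightarrow> traj s w x"
proof -
  obtain h where h: "h integrable_on {a..b}" "\<And>z u. z\<in>{a..b} \<Longrightarrow> u \<le> R \<Longrightarrow> F z u \<le> h z"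
    using F_bound[of R] by blast
  have flux: "(\<lambda>j. flux (\<sigma> j) (v j) y) \<longlonglongrightarrow> flux s w y" if y: "y \<in> {a..b}" for y
    unfolding flux_def
  proof (intro tendsto_diff s(1) dominated_convergence(2))
    show "(\<lambda>z. F z (v j z)) integrable_on {a..y}" for j using F_int_sub[OF vj] y by auto
    show "h integrable_on {a..y}" by (rule integrable_on_subinterval[OF h(1)]) (use y in auto)
    show "norm (F z (v j z)) \<le> h z" if "z \<in> {a..y}" for j z
      using h(2)[of z "v j z"] R[of z j] F_nonneg that y by auto
    show "(\<lambda>j. F z (v j z)) \<longlonglongrightarrow> F z (w z)" if "z \<in> {a..y}" for z
      by (rule continuous_on_tendsto_compose[OF F_cont lim]) (use that y in auto)
  qed
  obtain K where K: "\<And>s v y. s \<in> {lo..hi} \<Longrightarrow> continuous_on {a..b} v \<Longrightarrow> (\<And>z. z \<in> {a..b} \<Longrightarrow> v z \<le> R) \<Longrightarrow>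
       y \<in> {a..b} \<Longrightarrow> \<bar>\<psi> (flux s v y)\<bar> \<le> K"
    using slope_bounded[of lo hi R] by metis
  show ?thesis
    unfolding traj_def
  proof (rule dominated_convergence(2))
    show "(\<lambda>y. \<psi> (flux (\<sigma> j) (v j) y)) integrable_on {a..x}" for j using slope_int[OF vj] x by auto
    show "(\<lambda>y. K) integrable_on {a..x}" by auto
    show "norm (\<psi> (flux (\<sigma> j) (v j) y)) \<le> K" if "y \<in> {a..x}" for j y
      using K[OF s(2) vj R] that x by auto
    show "(\<lambda>j. \<psi> (flux (\<sigma> j) (v j) y)) \<longlonglongrightarrow> \<psi> (flux s w y)" if "y \<in> {a..x}" for y
      by (rule continuous_on_tendsto_compose[OF psi_cont flux]) (use that x in auto)
  qed
qed

section \<open>Shooting with delayed trajectories\<close>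

text \<open>
  With the delayed argument in \<open>F\<close>, the equation \<open>u = traj s (delay d u)\<close> has a unique solution
  depending continuously on \<open>s\<close>: its values up to \<open>a + k * d\<close> determine those up to
  \<open>a + (k + 1) * d\<close>, so finitely many iterations from any start reach it. This is Tonelli's way to
  get around the lack of uniqueness.
\<close>

definition delay :: "real \<Rightarrow> (real \<Rightarrow> real) \<Rightarrow> real \<Rightarrow> real" where
  "delay d u z = u (max a (z - d))"

lemma delay_cont: "continuous_on {a..b} u \<Longrightarrow> 0 \<le> d \<Longrightarrow> continuous_on {a..b} (delay d u)"
  unfolding delay_def[abs_def] by (rule continuous_on_compose2[where t="{a..b}" and g=u]) (use ab in \<open>auto intro!: continuous_intros\<close>)

definition approx :: "real \<Rightarrow> real \<Rightarrow> nat \<Rightarrow> real \<Rightarrow> real" where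
  "approx d s k = ((\<lambda>u. traj s (delay d u)) ^^ k) (\<lambda>_. 0)"

lemma approx_0 [simp]: "approx d s 0 = (\<lambda>_. 0)"
  and approx_Suc [simp]: "approx d s (Suc k) = traj s (delay d (approx d s k))"
  by (simp_all add: approx_def)

lemma approx_cont: "0 \<le> d \<Longrightarrow> continuous_on {a..b} (approx d s k)"
  by (induction k) (auto intro: traj_cont delay_cont)

lemma approx_le:
  assumes "0 \<le> d" "s \<le> S" "x \<in> {a..b}"
  shows "approx d s k x \<le> (b - a) * max 0 (\<psi> S)"
proof (cases k)
  case 0
  then show ?thesis using ab by simp
next
  case (Suc m)
  then show ?thesis using assms by (auto intro!: traj_le delay_cont approx_cont)
qed

lemma approx_stationary:
  assumes d: "0 < d"
  shows "x \<in> {a..b} \<Longrightarrow> x \<le> a + real k * d \<Longrightarrow> approx d s (Suc k) x = approx d s k x"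
proof (induction k arbitrary: x)
  case 0
  then have "x = a" by simp
  then show ?case by simp
next
  case (Suc k)
  have F: "integral {a..y} (\<lambda>z. F z (delay d (approx d s (Suc k)) z)) =
        integral {a..y} (\<lambda>z. F z (delay d (approx d s k) z))" if "y \<in> {a..x}" for y
  proof (rule Henstock_Kurzweil_Integration.integral_cong)
    fix z assume z: "z \<in> {a..y}"
    have "approx d s (Suc k) (max a (z - d)) = approx d s k (max a (z - d))"
      by (rule Suc.IH) (use z that Suc.prems d ab in \<open>auto simp: algebra_simps\<close>)
    then show "F z (delay d (approx d s (Suc k)) z) = F z (delay d (approx d s k) z)"
      by (simp only: delay_def)
  qed
  have "traj s (delay d (approx d s (Suc k))) x = traj s (delay d (approx d s k)) x"
    unfolding traj_def flux_def
    by (rule Henstock_Kurzweil_Integration.integral_cong) (use F in auto)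
  then show ?case by (simp only: approx_Suc)
qed

definition shot :: "real \<Rightarrow> real \<Rightarrow> real \<Rightarrow> real" where
  "shot d s = approx d s (nat \<lceil>(b - a) / d\<rceil>)"

lemma shot_cont: "0 \<le> d \<Longrightarrow> continuous_on {a..b} (shot d s)"
  unfolding shot_def by (rule approx_cont)

lemma shot_le: "0 \<le> d \<Longrightarrow> s \<le> S \<Longrightarrow> x \<in> {a..b} \<Longrightarrow> shot d s x \<le> (b - a) * max 0 (\<psi> S)"
  unfolding shot_def by (rule approx_le)

lemma shot_delayed_equation:
  assumes d: "0 < d" and x: "x \<in> {a..b}"
  shows "shot d s x = traj s (delay d (shot d s)) x"
proof -
  let ?k = "nat \<lceil>(b - a) / d\<rceil>"
  have "(b - a) / d \<le> real ?k" by linarith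
  then have "b - a \<le> real ?k * d" using d by (simp add: field_simps)
  then have "approx d s (Suc ?k) x = approx d s ?k x"
    using x by (intro approx_stationary[OF d]) auto
  then show ?thesis unfolding shot_def by simp
qed

lemma approx_continuous_dependence:
  assumes d: "0 \<le> d" and s: "\<sigma> \<longlonglongrightarrow> s" "\<And>j. \<sigma> j \<in> {lo..hi}" and x: "x \<in> {a..b}"
  shows "(\<lambda>j. approx d (\<sigma> j) k x) \<longlonglongrightarrow> approx d s k x"
  using x
proof (induction k arbitrary: x)
  case 0
  then show ?case by simp
next
  case (Suc k)
  show ?case unfolding approx_Suc
  proof (rule traj_continuous_dependence[OF s, where R="(b - a) * max 0 (\<psi> hi)"])
    show "delay d (approx d (\<sigma> j) k) z \<le> (b - a) * max 0 (\<psi> hi)" if "z \<in> {a..b}" for j z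
      unfolding delay_def by (rule approx_le) (use d s(2)[of j] that ab in auto)
    show "(\<lambda>j. delay d (approx d (\<sigma> j) k) z) \<longlonglongrightarrow> delay d (approx d s k) z" if "z \<in> {a..b}" for z
      unfolding delay_def by (rule Suc.IH) (use that ab d in auto)
  qed (use d Suc.prems in \<open>auto intro: delay_cont approx_cont\<close>)
qed

lemma shot_end_continuous:
  assumes "0 < d" shows "continuous_on {lo..hi} (\<lambda>s. shot d s b)"
  unfolding continuous_on_sequentially shot_def comp_def
  using approx_continuous_dependence[of d _ _ lo hi b] assms ab by auto

text \<open>
  The delayed trajectories are equi-Lipschitz, so the Arzela-Ascoli theorem gives a uniform limit;
  a Lipschitz function changes by at most a multiple of \<open>d\<close> under the delay, hence the limit
  satisfies the undelayed equation.
\<close>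

lemma shot_compactness:
  assumes s: "\<And>j. \<sigma> j \<in> {lo..hi}" and d: "\<And>j. 0 < d j" "d \<longlonglongrightarrow> 0"
  obtains r s u where "strict_mono (r :: nat \<Rightarrow> nat)" "s \<in> {lo..hi}" "(\<sigma> \<circ> r) \<longlonglongrightarrow> s" "exact s u"
    "(\<lambda>j. shot (d (r j)) (\<sigma> (r j)) b) \<longlonglongrightarrow> u b"
proof -
  obtain s r1 where r1: "strict_mono r1" "s \<in> {lo..hi}" "(\<sigma> \<circ> r1) \<longlonglongrightarrow> s"
    using compact_Icc[of lo hi, unfolded compact_eq_seq_compact_metric seq_compact_def] s by metis
  let ?R = "(b - a) * max 0 (\<psi> hi)"
  obtain K where K: "K > 0" "\<And>s v y. s \<in> {lo..hi} \<Longrightarrow> continuous_on {a..b} v \<Longrightarrow> (\<And>z. z \<in> {a..b} \<Longrightarrow> v z \<le> ?R) \<Longrightarrow>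
       y \<in> {a..b} \<Longrightarrow> \<bar>\<psi> (flux s v y)\<bar> \<le> K"
    using slope_bounded[of lo hi ?R] by metis
  define U where "U j = shot (d j) (\<sigma> j)" for j
  define V where "V j = delay (d j) (U j)" for j
  have Uc: "continuous_on {a..b} (U j)" for j unfolding U_def by (rule shot_cont) (use d(1)[of j] in simp)
  have Vc: "continuous_on {a..b} (V j)" for j unfolding V_def by (rule delay_cont[OF Uc]) (use d(1)[of j] in simp)
  have UR: "U j z \<le> ?R" if "z \<in> {a..b}" for j z
    unfolding U_def by (rule shot_le) (use d(1)[of j] s[of j] that in auto)
  have VR: "V j z \<le> ?R" if "z \<in> {a..b}" for j z
    unfolding V_def delay_def by (rule UR) (use d(1)[of j] that ab in auto)
  have Ueq: "U j x = traj (\<sigma> j) (V j) x" if "x \<in> {a..b}" for j x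
    unfolding V_def U_def by (rule shot_delayed_equation[OF d(1) that])
  have Lip0: "\<bar>U j y - U j x\<bar> \<le> K * (y - x)" if "a \<le> x" "x \<le> y" "y \<le> b" for j x y
  proof -
    have "U j y - U j x = integral {x..y} (\<lambda>z. \<psi> (flux (\<sigma> j) (V j) z))"
      using traj_diff[OF Vc that] Ueq that by auto
    moreover have "norm (integral {x..y} (\<lambda>z. \<psi> (flux (\<sigma> j) (V j) z))) \<le> K * (y - x)"
    proof (rule integral_bound[OF that(2)])
      show "continuous_on {x..y} (\<lambda>z. \<psi> (flux (\<sigma> j) (V j) z))"
        by (rule continuous_on_subset[OF slope_cont[OF Vc]]) (use that in auto)
    qed (use K(2)[OF s Vc VR] that in auto)
    ultimately show ?thesis by simp
  qed
  have Lip: "\<bar>U j y - U j x\<bar> \<le> K * \<bar>y - x\<bar>" if "x \<in> {a..b}" "y \<in> {a..b}" for j x y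
    using Lip0[of x y j] Lip0[of y x j] that by (cases "x \<le> y") (auto simp: abs_minus_commute)
  have Ua: "U j a = 0" for j using Ueq[of a j] ab by simp
  obtain u r2 where u: "continuous_on {a..b} u" and r2: "strict_mono (r2 :: nat \<Rightarrow> nat)"
    and conv: "\<And>e. 0 < e \<Longrightarrow> \<exists>N. \<forall>n x. n \<ge> N \<and> x \<in> {a..b} \<longrightarrow> norm (U (r1 (r2 n)) x - u x) < e"
  proof (rule Arzela_Ascoli[of "{a..b}" "\<lambda>n. U (r1 n)" "K * (b - a)"])
    show "compact {a..b}" by simp
    show "norm (U (r1 n) x) \<le> K * (b - a)" if "x \<in> {a..b}" for n x
    proof -
      have "\<bar>U (r1 n) x\<bar> \<le> K * (x - a)" using Lip[of a x "r1 n"] Ua that by auto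
      also have "\<dots> \<le> K * (b - a)" using K that by auto
      finally show ?thesis by simp
    qed
    show "\<exists>d>0. \<forall>n y. y \<in> {a..b} \<and> norm (x - y) < d \<longrightarrow> norm (U (r1 n) x - U (r1 n) y) < e"
      if "x \<in> {a..b}" "0 < e" for x e
    proof (intro exI[of _ "e / K"] conjI allI impI)
      fix n y assume y: "y \<in> {a..b} \<and> norm (x - y) < e / K"
      have "\<bar>U (r1 n) x - U (r1 n) y\<bar> \<le> K * \<bar>x - y\<bar>" using Lip y that by blast
      also have "\<dots> < e" using y K by (simp add: field_simps)
      finally show "norm (U (r1 n) x - U (r1 n) y) < e" by simp
    qed (use that K in simp)
  qed blast
  let ?r = "r1 \<circ> r2"
  have r: "strict_mono ?r" using r1 r2 by (simp add: strict_mono_o)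
  have sr: "(\<lambda>j. \<sigma> (?r j)) \<longlonglongrightarrow> s" using LIMSEQ_subseq_LIMSEQ[OF r1(3) r2] by (simp add: o_def)
  have dr: "(\<lambda>j. d (?r j)) \<longlonglongrightarrow> 0" using LIMSEQ_subseq_LIMSEQ[OF d(2) r] by (simp add: o_def)
  have Ulim: "(\<lambda>j. U (?r j) x) \<longlonglongrightarrow> u x" if "x \<in> {a..b}" for x
    using conv that unfolding LIMSEQ_iff comp_def by blast
  have Vlim: "(\<lambda>j. V (?r j) z) \<longlonglongrightarrow> u z" if z: "z \<in> {a..b}" for z
  proof -
    have "(\<lambda>j. V (?r j) z - U (?r j) z) \<longlonglongrightarrow> 0"
    proof (rule Lim_null_comparison)
      show "\<forall>\<^sub>F j in sequentially. norm (V (?r j) z - U (?r j) z) \<le> K * d (?r j)"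
      proof (rule always_eventually, rule allI)
        fix j
        have dj: "0 < d (?r j)" by (rule d)
        have "\<bar>V (?r j) z - U (?r j) z\<bar> \<le> K * \<bar>max a (z - d (?r j)) - z\<bar>"
          unfolding V_def delay_def by (rule Lip) (use z dj ab in auto)
        also have "\<dots> \<le> K * d (?r j)" using z dj K by (intro mult_left_mono) auto
        finally show "norm (V (?r j) z - U (?r j) z) \<le> K * d (?r j)" by simp
      qed
      show "(\<lambda>j. K * d (?r j)) \<longlonglongrightarrow> 0" using tendsto_mult_left[OF dr, of K] by simp
    qed
    from tendsto_add[OF this Ulim[OF z]] show ?thesis by simp
  qed
  have "u x = traj s u x" if x: "x \<in> {a..b}" for x
  proof (rule LIMSEQ_unique[OF Ulim[OF x]])
    show "(\<lambda>j. U (?r j) x) \<longlonglongrightarrow> traj s u x"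
      unfolding Ueq[OF x]
      by (rule traj_continuous_dependence[OF sr s Vc u VR Vlim x])
  qed
  then have "exact s u" using u by (simp add: exact_def)
  then show ?thesis
    using that[OF r r1(2) _ _ , of u] sr Ulim[of b] ab by (simp add: o_def U_def)
qed

text \<open>
  Otherwise compactness would produce an exact trajectory violating the assumption. This transfers
  sign information from all exact trajectories to delayed ones, so no estimate ever has to be
  carried out with a delay. The factor \<open>e\<close> allows for both signs.
\<close>

lemma shot_sign:
  assumes neg: "\<And>u. exact s u \<Longrightarrow> e * u b < 0"
  shows "\<exists>d0>0. \<forall>d. 0 < d \<and> d < d0 \<longrightarrow> e * shot d s b < 0"
proof (rule ccontr)
  assume "\<not> ?thesis"
  then have no: "\<And>d0. 0 < d0 \<Longrightarrow> \<exists>d. 0 < d \<and> d < d0 \<and> e * shot d s b \<ge> 0"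
    by (meson not_less)
  have "\<forall>j. \<exists>d. 0 < d \<and> d < 1 / real (Suc j) \<and> e * shot d s b \<ge> 0"
    by (intro allI no) simp
  then obtain d where d: "\<And>j. 0 < d j" "\<And>j. d j < 1 / real (Suc j)" "\<And>j. e * shot (d j) s b \<ge> 0"
    by metis
  have dlim: "d \<longlonglongrightarrow> 0"
    by (rule tendsto_sandwich[OF _ _ tendsto_const LIMSEQ_Suc[OF lim_1_over_n]])
      (use d in \<open>auto intro!: always_eventually less_imp_le simp: add.commute\<close>)
  obtain r s' u where r: "s' \<in> {s..s}" "exact s' u"
    "(\<lambda>j. shot (d (r j)) s b) \<longlonglongrightarrow> u b"
    by (rule shot_compactness[of "\<lambda>_. s" s s d, OF _ d(1) dlim]) auto
  have "0 \<le> e * u b"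
    by (rule tendsto_lowerbound[OF tendsto_mult_left[OF r(3)]]) (use d in auto)
  then show False using neg[of u] r by simp
qed

text \<open>
  An intermediate value theorem for the set-valued shooting map. The usual one applies to each small
  delay, where the end value is a continuous function of \<open>s\<close>, and the zeros found there accumulate
  at an exact one.
\<close>

theorem exact_zero_between:
  assumes "lo \<le> hi" and lo: "\<And>u. exact lo u \<Longrightarrow> e * u b < 0" and hi: "\<And>u. exact hi u \<Longrightarrow> e * u b > 0"
  obtains s u where "s \<in> {lo..hi}" "exact s u" "u b = 0"
proof -
  obtain d1 where d1: "d1 > 0" "\<And>d. 0 < d \<Longrightarrow> d < d1 \<Longrightarrow> e * shot d lo b < 0"
    using shot_sign[of lo e] lo by blast
  obtain d2 where d2: "d2 > 0" "\<And>d. 0 < d \<Longrightarrow> d < d2 \<Longrightarrow> - e * shot d hi b < 0"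
    using shot_sign[of hi "- e"] hi by auto
  have "e \<noteq> 0" using d1(2)[of "d1/2"] d1(1) by auto
  define d where "d j = min d1 d2 / real (Suc (Suc j))" for j
  have "d j < min d1 d2" for j
  proof -
    have "min d1 d2 * 1 < min d1 d2 * real (Suc (Suc j))"
      using d1(1) d2(1) by (intro mult_strict_left_mono) auto
    then show ?thesis unfolding d_def by (simp only: divide_less_eq of_nat_0_less_iff zero_less_Suc if_True mult_1_right)
  qed
  then have d: "0 < d j" "d j < d1" "d j < d2" for j
    using d1(1) d2(1) by (auto simp: d_def)
  have dlim: "d \<longlonglongrightarrow> 0"
    using LIMSEQ_Suc[OF LIMSEQ_Suc[OF lim_const_over_n[of "min d1 d2"]]] unfolding d_def by simp
  have "\<exists>s\<in>{lo..hi}. shot (d j) s b = 0" for j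
  proof -
    have "\<exists>s\<ge>lo. s \<le> hi \<and> e * shot (d j) s b = 0"
    proof (rule IVT')
      show "e * shot (d j) lo b \<le> 0" using d1(2)[OF d(1,2)] by (rule less_imp_le)
      show "0 \<le> e * shot (d j) hi b" using d2(2)[OF d(1,3), of j] by simp
      show "continuous_on {lo..hi} (\<lambda>s. e * shot (d j) s b)"
        by (intro continuous_intros shot_end_continuous d)
    qed fact
    then show ?thesis using \<open>e \<noteq> 0\<close> by auto
  qed
  then obtain \<sigma> where \<sigma>: "\<And>j. \<sigma> j \<in> {lo..hi}" "\<And>j. shot (d j) (\<sigma> j) b = 0" by metis
  obtain r s u where "s \<in> {lo..hi}" "exact s u" "(\<lambda>j. shot (d (r j)) (\<sigma> (r j)) b) \<longlonglongrightarrow> u b"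
    by (rule shot_compactness[of \<sigma> lo hi d, OF \<sigma>(1) d(1) dlim]) blast
  moreover from this have "u b = 0" using \<sigma>(2) by (simp add: LIMSEQ_const_iff)
  ultimately show ?thesis using that by blast
qed

section \<open>Concavity of exact trajectories\<close>

lemma exact_cont: "exact s u \<Longrightarrow> continuous_on {a..b} u"
  by (simp add: exact_def)

lemma exact_start: "exact s u \<Longrightarrow> u a = 0"
  using ab by (simp add: exact_def)

lemma exact_deriv:
  assumes "exact s u" "x \<in> {a..b}"
  shows "(u has_real_derivative \<psi> (flux s u x)) (at x within {a..b})"
  by (rule has_field_derivative_transform_within[OF traj_deriv[OF exact_cont[OF assms(1)] assms(2)] zero_less_one assms(2)])
     (use assms in \<open>auto simp: exact_def\<close>)

lemma exact_deriv_on: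
  assumes "exact s u" "x \<in> {a..b}"
  shows "deriv_on a b u x = \<psi> (flux s u x)"
  unfolding deriv_on_def
  using vector_derivative_within_closed_interval[OF ab assms(2)] exact_deriv[OF assms]
  by (simp add: has_real_derivative_iff_has_vector_derivative)

lemma exact_tangent:
  assumes "exact s u" "y \<in> {a..b}" "z \<in> {a..b}"
  shows "u z \<le> u y + \<psi> (flux s u y) * (z - y)"
  using tangent[OF exact_cont[OF assms(1)] assms(2,3), of s] assms by (simp add: exact_def)

text \<open>
  The tangent at \<open>x\<close>, evaluated at \<open>p\<close> and at \<open>q\<close>; the slope cancels in the weighted sum.
\<close>

lemma exact_chord:
  assumes "exact s u" and "p \<in> {a..b}" "q \<in> {a..b}" "p \<le> x" "x \<le> q"
  shows "(x - p) * u q + (q - x) * u p \<le> (q - p) * u x"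
proof -
  have x: "x \<in> {a..b}" using assms by auto
  let ?m = "\<psi> (flux s u x)"
  have "(x - p) * u q \<le> (x - p) * (u x + ?m * (q - x))"
    by (rule mult_left_mono[OF exact_tangent]) (use assms x in auto)
  moreover have "(q - x) * u p \<le> (q - x) * (u x + ?m * (p - x))"
    by (rule mult_left_mono[OF exact_tangent]) (use assms x in auto)
  ultimately show ?thesis by (simp add: algebra_simps)
qed

lemma exact_nonneg:
  assumes "exact s u" "0 \<le> u b" "x \<in> {a..b}"
  shows "0 \<le> u x"
proof -
  have "0 \<le> (x - a) * u b" using assms by simp
  also have "\<dots> \<le> (b - a) * u x"
    using exact_chord[OF assms(1), of a b x] exact_start[OF assms(1)] assms ab by auto
  finally show ?thesis using ab by (simp add: zero_le_mult_iff)
qed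

text \<open>
  A nonnegative concave function is at least its maximum times the relative distance to the
  boundary. For a trajectory with \<open>u b \<ge> 0\<close> this controls it from below, by its maximum alone, on
  any compact part of the interval.
\<close>

lemma exact_concave_lower_bound:
  assumes u: "exact s u" "0 \<le> u b" and x: "x \<in> {a..b}" and y: "y \<in> {a..b}"
    and d: "0 \<le> d" "d \<le> x - a" "d \<le> b - x"
  shows "d * u y \<le> (b - a) * u x"
proof (cases "x \<le> y")
  case True
  have "d * u y \<le> (x - a) * u y" using d exact_nonneg[OF u y] by (intro mult_right_mono)
  also have "\<dots> \<le> (y - a) * u x"
    using exact_chord[OF u(1), of a y x] exact_start[OF u(1)] True x y ab by auto
  also have "\<dots> \<le> (b - a) * u x" using exact_nonneg[OF u x] y by (intro mult_right_mono) auto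
  finally show ?thesis .
next
  case False
  have "d * u y \<le> (b - x) * u y" using d exact_nonneg[OF u y] by (intro mult_right_mono)
  also have "\<dots> \<le> (x - y) * u b + (b - x) * u y" using False u by simp
  also have "\<dots> \<le> (b - y) * u x"
    by (rule exact_chord[OF u(1)]) (use False x y ab in auto)
  also have "\<dots> \<le> (b - a) * u x" using exact_nonneg[OF u x] y by (intro mult_right_mono) auto
  finally show ?thesis .
qed

lemma exact_positive_somewhere:
  assumes "exact s u" "0 < s"
  obtains y where "y \<in> {a<..<b}" "0 < u y"
proof -
  have "0 < \<psi> s" using psi_mono psi_0 assms(2) by (metis strict_monoD)
  moreover have "(u has_real_derivative \<psi> s) (at a within {a..b})"
    using exact_deriv[OF assms(1), of a] ab by simp
  ultimately obtain d where d: "d > 0" "\<And>h. 0 < h \<Longrightarrow> a + h \<in> {a..b} \<Longrightarrow> h < d \<Longrightarrow> u a < u (a + h)"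
    using has_real_derivative_pos_inc_right by blast
  define h where "h = min d (b - a) / 2"
  have h: "0 < h" "h < d" "h < b - a" using d ab by (auto simp: h_def)
  then have "0 < u (a + h)" using d(2)[of h] exact_start[OF assms(1)] by auto
  then show ?thesis using that[of "a + h"] h by auto
qed

lemma exact_slope_start_bound:
  assumes u: "exact s u" and d: "0 < d" "a + d \<le> b"
  shows "d * \<psi> (flux s u (a + d)) \<le> u (a + d)"
  using exact_tangent[OF u, of "a + d" a] exact_start[OF u] d ab by (auto simp: algebra_simps)

lemma exact_slope_end_bound:
  assumes u: "exact s u" "0 \<le> u b" and d: "0 < d" "a + d \<le> b"
  shows "- u (b - d) \<le> d * \<psi> (flux s u (b - d))"
  using exact_tangent[OF u(1), of "b - d" b] u(2) d ab by (auto simp: algebra_simps)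

text \<open>
  Positivity is the concave lower bound applied to a point near \<open>a\<close> at which \<open>u\<close> is positive, and
  the end slope is negative because the tangent at \<open>b\<close> lies above that point.
\<close>

lemma exact_solution_in_P_circ:
  assumes u: "exact s u" "u b = 0" and s: "0 < s" and phi: "\<And>y. \<phi> (\<psi> y) = y"
  shows "solution_in_P_circ a b \<phi> F u"
proof -
  obtain y where y: "y \<in> {a<..<b}" "0 < u y" using exact_positive_somewhere[OF u(1) s] by blast
  have pos: "0 < u x" if x: "x \<in> {a<..<b}" for x
  proof -
    have "0 < min (x - a) (b - x) * u y" using x y by simp
    also have "\<dots> \<le> (b - a) * u x"
      by (rule exact_concave_lower_bound[OF u(1)]) (use u x y in auto)
    finally show ?thesis using ab by (simp add: zero_less_mult_iff)
  qed
  have "0 < \<psi> (flux s u b) * (y - b)"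
    using exact_tangent[OF u(1), of b y] u(2) y ab by auto
  then have end_slope: "\<psi> (flux s u b) < 0" using y by (auto simp: zero_less_mult_iff)
  have start_slope: "0 < \<psi> (flux s u a)" using psi_mono psi_0 s by (metis strict_monoD flux_start)
  have cont_deriv: "continuous_on {a..b} (deriv_on a b u)"
    by (rule continuous_on_eq[OF slope_cont[OF exact_cont[OF u(1)], of s]]) (simp add: exact_deriv_on[OF u(1)])
  have diff: "u differentiable_on {a..b}"
    unfolding differentiable_on_def
    using exact_deriv[OF u(1)] real_differentiable_def by blast
  have "u \<in> P_circ a b"
    unfolding P_circ_def C1_0_def
    using diff cont_deriv exact_start[OF u(1)] u(2) pos end_slope start_slope ab
    by (auto simp: exact_deriv_on[OF u(1)])
  moreover have flux_eq: "\<phi> (deriv_on a b u x) = flux s u x" if "x \<in> {a..b}" for x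
    using that by (simp add: exact_deriv_on[OF u(1)] phi)
  have "abs_cont_on a b (\<lambda>x. \<phi> (deriv_on a b u x))"
    by (rule abs_cont_on_indefinite_integral[OF F_int[OF exact_cont[OF u(1)]]])
       (auto simp: F_nonneg flux_eq flux_def)
  moreover have "AE x\<in>{a<..<b} in lebesgue.
        \<exists>d. ((\<lambda>y. \<phi> (deriv_on a b u y)) has_real_derivative d) (at x) \<and> - d = F x (u x)"
    using AE_has_derivative_indefinite_integral[OF F_int[OF exact_cont[OF u(1)]]]
  proof (rule AE_mp, intro AE_I2 impI)
    fix x
    assume x: "x \<in> {a<..<b}" and "x \<in> {a<..<b} \<longrightarrow>
      ((\<lambda>x. integral {a..x} (\<lambda>z. F z (u z))) has_real_derivative F x (u x)) (at x)"
    then have D: "((\<lambda>x. integral {a..x} (\<lambda>z. F z (u z))) has_real_derivative F x (u x)) (at x)" by blast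
    have "(flux s u has_real_derivative 0 - F x (u x)) (at x)"
      unfolding flux_def[abs_def] by (intro DERIV_diff DERIV_const D)
    then have "(flux s u has_real_derivative - F x (u x)) (at x)" by simp
    then have "((\<lambda>y. \<phi> (deriv_on a b u y)) has_real_derivative - F x (u x)) (at x)"
      by (rule has_field_derivative_transform_within_open[where S="{a<..<b}"])
         (use x flux_eq in auto)
    then show "\<exists>d. ((\<lambda>y. \<phi> (deriv_on a b u y)) has_real_derivative d) (at x) \<and> - d = F x (u x)"
      by (intro exI[of _ "- F x (u x)"]) simp
  qed
  ultimately show ?thesis unfolding solution_in_P_circ_def by blast
qed

lemma exact_le: "exact s u \<Longrightarrow> 0 \<le> s \<Longrightarrow> x \<in> {a..b} \<Longrightarrow> u x \<le> (b - a) * \<psi> s"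
  using traj_le[of u x s s] psi_le[of 0 s] psi_0 by (simp add: exact_def max_def)

text \<open>
  If \<open>F\<close> cannot use up the initial flux, the slope stays positive up to \<open>b\<close>.
\<close>

lemma exact_positive_end:
  assumes s: "0 < s" and h: "h integrable_on {a..b}"
    and F: "\<And>z u. z \<in> {a..b} \<Longrightarrow> u \<le> (b - a) * \<psi> s \<Longrightarrow> F z u \<le> h z"
    and small: "integral {a..b} h < s" and u: "exact s u"
  shows "0 < u b"
proof -
  have "integral {a..b} (\<lambda>z. F z (u z)) \<le> integral {a..b} h"
    by (rule integral_le[OF F_int[OF exact_cont[OF u]] h]) (use F exact_le[OF u] s in auto)
  then have "0 < flux s u b" using small by (simp add: flux_def)
  then have "0 < \<psi> (flux s u b)" using psi_mono psi_0 by (metis strict_monoD)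
  then have "0 < \<psi> (flux s u b) * (b - a)" using ab by simp
  also have "\<dots> \<le> u b"
    using exact_tangent[OF u, of b a] exact_start[OF u] ab by (simp add: algebra_simps)
  finally show ?thesis .
qed

lemma exact_max:
  assumes "exact s u"
  obtains y where "y \<in> {a..b}" "\<And>x. x \<in> {a..b} \<Longrightarrow> u x \<le> u y"
  using continuous_attains_sup[of "{a..b}" u] exact_cont[OF assms] ab by auto

text \<open>
  The conflict that rules out \<open>u b \<ge> 0\<close> for certain maxima \<open>u y\<close>. At distance \<open>d\<close> from the
  boundary the slopes of a nonnegative concave function are at most \<open>u y / d\<close> in absolute value, so
  the flux can drop by at most twice \<open>\<phi> (u y / d)\<close> in between; but the drop is the integral of \<open>F\<close>,
  and there \<open>u\<close> is bounded below by a fixed fraction of its maximum.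
\<close>

lemma exact_flux_drop:
  assumes u: "exact s u" "0 \<le> u b" and phi: "strict_mono \<phi>" "\<And>y. \<phi> (\<psi> y) = y" "\<And>y. \<phi> (- y) = - \<phi> y"
    and y: "y \<in> {a..b}" "\<And>x. x \<in> {a..b} \<Longrightarrow> u x \<le> u y"
    and d: "0 < d" "d \<le> (b - a) / 2"
    and w: "w integrable_on {a + d..b - d}"
    and low: "\<And>z t. z \<in> {a + d..b - d} \<Longrightarrow> d / (b - a) * u y \<le> t \<Longrightarrow> t \<le> u y \<Longrightarrow> w z * L \<le> F z t"
  shows "integral {a + d..b - d} w * L \<le> 2 * \<phi> (u y / d)"
proof -
  have d': "a + d \<le> b - d" "a + d \<le> b" using d by (auto simp: field_simps)
  have le: "\<phi> p \<le> \<phi> q" if "p \<le> q" for p q using that phi(1) by (simp add: strict_mono_less_eq)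
  have "integral {a + d..b - d} w * L = integral {a + d..b - d} (\<lambda>z. w z * L)" by simp
  also have "\<dots> \<le> integral {a + d..b - d} (\<lambda>z. F z (u z))"
  proof (rule integral_le)
    show "(\<lambda>z. w z * L) integrable_on {a + d..b - d}" using w by (rule integrable_on_mult_left)
    show "(\<lambda>z. F z (u z)) integrable_on {a + d..b - d}"
      by (rule F_int_sub[OF exact_cont[OF u(1)]]) (use d in auto)
    fix z assume z: "z \<in> {a + d..b - d}"
    have "d * u y \<le> (b - a) * u z"
      by (rule exact_concave_lower_bound[OF u]) (use z y d in auto)
    then show "w z * L \<le> F z (u z)"
      using low[OF z, of "u z"] y(2)[of z] z d ab by (simp add: field_simps)
  qed
  finally have "integral {a + d..b - d} w * L \<le> integral {a + d..b - d} (\<lambda>z. F z (u z))" .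
  moreover have "integral {a + d..b - d} (\<lambda>z. F z (u z)) = flux s u (a + d) - flux s u (b - d)"
    by (rule flux_diff[OF exact_cont[OF u(1)], symmetric]) (use d d' in auto)
  moreover have "flux s u (a + d) \<le> \<phi> (u y / d)"
  proof -
    have "\<psi> (flux s u (a + d)) \<le> u y / d"
      using exact_slope_start_bound[OF u(1) d(1) d'(2)] y(2)[of "a + d"] d d' by (simp add: field_simps)
    from le[OF this] show ?thesis by (simp add: phi)
  qed
  moreover have "- flux s u (b - d) \<le> \<phi> (u y / d)"
  proof -
    have "- (u y / d) \<le> \<psi> (flux s u (b - d))"
      using exact_slope_end_bound[OF u d(1) d'(2)] y(2)[of "b - d"] d d' by (simp add: field_simps)
    from le[OF this] show ?thesis by (simp add: phi)
  qed
  ultimately show ?thesis by simp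
qed

text \<open>
  For a power, both sides can be written in terms of \<open>u y / d\<close>. This is why the hypotheses compare
  \<open>\<phi>\<close> with powers: constants inside a power come out, whereas \<open>\<phi> (C * t)\<close> need not be comparable
  with \<open>\<phi> t\<close>.
\<close>

lemma exact_power_drop:
  assumes u: "exact s u" "0 \<le> u b" and phi: "strict_mono \<phi>" "\<And>y. \<phi> (\<psi> y) = y" "\<And>y. \<phi> (- y) = - \<phi> y"
    and y: "y \<in> {a..b}" "\<And>x. x \<in> {a..b} \<Longrightarrow> u x \<le> u y" "0 < u y"
    and d: "0 < d" "d \<le> (b - a) / 2"
    and w: "w integrable_on {a + d..b - d}" "\<And>z. 0 \<le> w z" and c: "0 \<le> c" and q: "0 \<le> q"
    and low: "\<And>z t. z \<in> {a + d..b - d} \<Longrightarrow> d / (b - a) * u y \<le> t \<Longrightarrow> t \<le> u y \<Longrightarrow> w z * (c * t powr q) \<le> F z t"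
  shows "integral {a + d..b - d} w * c * (d * d / (b - a)) powr q * (u y / d) powr q \<le> 2 * \<phi> (u y / d)"
proof -
  let ?t = "d / (b - a) * u y"
  have t: "0 \<le> ?t" using d ab y by simp
  have "integral {a + d..b - d} w * (c * ?t powr q) \<le> 2 * \<phi> (u y / d)"
  proof (rule exact_flux_drop[OF u phi y(1,2) d w(1)])
    fix z t assume z: "z \<in> {a + d..b - d}" "?t \<le> t" "t \<le> u y"
    have "w z * (c * ?t powr q) \<le> w z * (c * t powr q)"
      using w(2)[of z] c q t z by (intro mult_left_mono powr_mono2)
    with low[OF z] show "w z * (c * ?t powr q) \<le> F z t" by linarith
  qed
  moreover have "?t = (d * d / (b - a)) * (u y / d)" using d by simp
  then have "?t powr q = (d * d / (b - a)) powr q * (u y / d) powr q"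
    by (simp only: powr_mult)
  ultimately show ?thesis by (simp only: mult.assoc)
qed

text \<open>
  The start value is recovered from the derivative at \<open>a\<close>; so distinct start values give distinct
  trajectories.
\<close>

lemma exact_inject:
  assumes u: "exact s u" and v: "exact s' v" and eq: "\<And>x. x \<in> {a..b} \<Longrightarrow> u x = v x"
  shows "s = s'"
proof -
  have a: "a \<in> {a..b}" using ab by simp
  have "(v has_real_derivative \<psi> s) (at a within {a..b})"
    by (rule has_field_derivative_transform_within[OF exact_deriv[OF u a, simplified] zero_less_one a]) (use eq in auto)
  then have "deriv_on a b v a = \<psi> s"
    unfolding deriv_on_def
    using vector_derivative_within_closed_interval[OF ab a]
    by (simp add: has_real_derivative_iff_has_vector_derivative)
  moreover have "deriv_on a b v a = \<psi> s'" using exact_deriv_on[OF v a] by simp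
  ultimately show ?thesis using strict_mono_eq[OF psi_mono] by metis
qed

text \<open>
  If all trajectories with \<open>u b \<ge> 0\<close> have a common upper bound, then their flux at \<open>b\<close> is bounded
  above (the end slope is at most the mean slope), and so is the total drop of the flux, hence also
  the initial flux.
\<close>

lemma exact_negative_end_of_large_start:
  assumes phi: "strict_mono \<phi>" "\<And>y. \<phi> (\<psi> y) = y"
    and U: "\<And>s u x. exact s u \<Longrightarrow> 0 \<le> u b \<Longrightarrow> x \<in> {a..b} \<Longrightarrow> u x \<le> U"
  shows "\<exists>S. \<forall>s u. S < s \<longrightarrow> exact s u \<longrightarrow> u b < 0"
proof -
  obtain h where h: "h integrable_on {a..b}" "\<And>z u. z\<in>{a..b} \<Longrightarrow> u \<le> U \<Longrightarrow> F z u \<le> h z"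
    using F_bound[of U] by blast
  have "s \<le> \<phi> (U / (b - a)) + integral {a..b} h" if u: "exact s u" "0 \<le> u b" for s u
  proof -
    have "(b - a) * \<psi> (flux s u b) \<le> u b"
      using exact_slope_start_bound[OF u(1), of "b - a"] ab by simp
    also have "\<dots> \<le> U" using U[OF u, of b] ab by simp
    finally have "\<psi> (flux s u b) \<le> U / (b - a)" using ab by (simp add: field_simps)
    then have "\<phi> (\<psi> (flux s u b)) \<le> \<phi> (U / (b - a))" using phi(1) by (simp add: strict_mono_less_eq)
    then have "flux s u b \<le> \<phi> (U / (b - a))" by (simp add: phi)
    moreover have "integral {a..b} (\<lambda>z. F z (u z)) \<le> integral {a..b} h"
      by (rule integral_le[OF F_int[OF exact_cont[OF u(1)]] h(1)]) (use h U[OF u] in auto)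
    ultimately show ?thesis by (simp add: flux_def)
  qed
  then show ?thesis by (meson not_less)
qed

end

section \<open>Weights and nonlinearities\<close>

lemma integrable_mult_continuous:
  fixes m c :: "real \<Rightarrow> real"
  assumes m: "m integrable_on {a..b}" "\<And>x. 0 \<le> m x" and c: "continuous_on {a..b} c"
  shows "(\<lambda>z. m z * c z) integrable_on {a..b}"
proof -
  have "(\<lambda>z. c z * m z) absolutely_integrable_on {a..b}"
  proof (rule absolutely_integrable_bounded_measurable_product_real)
    show "c \<in> borel_measurable (lebesgue_on {a..b})"
      using c by (rule continuous_imp_measurable_on_sets_lebesgue) simp
    show "bounded (c ` {a..b})"
      using compact_imp_bounded compact_continuous_image[OF c compact_Icc] by blast
    show "m absolutely_integrable_on {a..b}" using m by (intro nonnegative_absolutely_integrable_1)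
  qed simp
  then show ?thesis by (simp add: mult.commute set_lebesgue_integral_eq_integral(1))
qed

lemma continuous_bounded_above_on_Icc:
  fixes f :: "real \<Rightarrow> real"
  assumes "continuous_on {0..} f"
  obtains C where "0 < C" "\<And>t. t \<in> {0..R} \<Longrightarrow> f t \<le> C"
proof -
  have "bounded (f ` {0..R})"
    by (intro compact_imp_bounded compact_continuous_image continuous_on_subset[OF assms]) auto
  then obtain C where C: "0 < C" "\<And>y. y \<in> f ` {0..R} \<Longrightarrow> norm y \<le> C" unfolding bounded_pos by blast
  show ?thesis
  proof (rule that[OF C(1)])
    fix t assume "t \<in> {0..R}"
    then have "norm (f t) \<le> C" using C by blast
    then show "f t \<le> C" by simp
  qed
qed

text \<open>
  Cutting off with \<open>max 0\<close> makes the right-hand side meaningful and nonnegative along trajectories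
  that become negative; it has no effect on solutions in \<open>P_circ\<close>.
\<close>

lemma shooting_separated:
  fixes m n f g :: "real \<Rightarrow> real"
  assumes "a < b" "continuous_on UNIV \<psi>" "strict_mono \<psi>" "\<psi> 0 = 0"
    and f: "continuous_on {0..} f" "\<forall>t\<ge>0. f t \<ge> 0"
    and g: "continuous_on {0..} g" "\<forall>t\<ge>0. g t \<ge> 0"
    and m: "m integrable_on {a..b}" "\<And>x. 0 \<le> m x"
    and n: "n integrable_on {a..b}" "\<And>x. 0 \<le> n x"
    and "0 \<le> l" "0 \<le> k"
  shows "shooting a b \<psi> (\<lambda>z u. l * m z * f (max 0 u) + k * n z * g (max 0 u))" (is "shooting _ _ _ ?F")
proof
  fix v :: "real \<Rightarrow> real" assume v: "continuous_on {a..b} v"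
  have c: "continuous_on {a..b} (\<lambda>z. f (max 0 (v z)))" "continuous_on {a..b} (\<lambda>z. g (max 0 (v z)))"
    by (rule continuous_on_compose2[OF f(1)] continuous_on_compose2[OF g(1)]; auto intro!: continuous_intros v)+
  have "(\<lambda>z. m z * f (max 0 (v z))) integrable_on {a..b}" "(\<lambda>z. n z * g (max 0 (v z))) integrable_on {a..b}"
    by (rule integrable_mult_continuous[OF m c(1)], rule integrable_mult_continuous[OF n c(2)])
  then have "(\<lambda>z. l * (m z * f (max 0 (v z))) + k * (n z * g (max 0 (v z)))) integrable_on {a..b}"
    by (intro integrable_add integrable_on_mult_right)
  then show "(\<lambda>z. ?F z (v z)) integrable_on {a..b}" by (simp add: mult.assoc)
next
  show "0 \<le> ?F z u" for z u using assms by simp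
next
  fix R
  obtain C where C: "0 < C" "\<And>t. t \<in> {0..max 0 R} \<Longrightarrow> f t \<le> C"
    using continuous_bounded_above_on_Icc[OF f(1)] by metis
  obtain D where D: "0 < D" "\<And>t. t \<in> {0..max 0 R} \<Longrightarrow> g t \<le> D"
    using continuous_bounded_above_on_Icc[OF g(1)] by metis
  let ?h = "\<lambda>z. l * m z * C + k * n z * D"
  have "?h integrable_on {a..b}"
    by (intro integrable_add integrable_on_mult_left integrable_on_mult_right m n)
  moreover have "?F z u \<le> ?h z" if "u \<le> R" for z u
  proof -
    have "f (max 0 u) \<le> C" "g (max 0 u) \<le> D" using C(2) D(2) that by auto
    then show ?thesis using assms by (intro add_mono mult_left_mono) auto
  qed
  ultimately show "\<exists>h. h integrable_on {a..b} \<and> (\<forall>z\<in>{a..b}. \<forall>u\<le>R. ?F z u \<le> h z)" by blast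
next
  show "continuous_on UNIV (?F z)" for z
    by (intro continuous_intros continuous_on_compose2[OF f(1)] continuous_on_compose2[OF g(1)]) auto
qed fact+

text \<open>
  Replacing the weight by its positive part changes it only on a null set and makes pointwise
  estimates available everywhere.
\<close>

lemma nonneg_representative:
  fixes m :: "real \<Rightarrow> real"
  assumes m: "set_integrable lebesgue {a<..<b} m"
           "AE x\<in>{a<..<b} in lebesgue. 0 \<le> m x"
           "\<not> (AE x\<in>{a<..<b} in lebesgue. m x = 0)"
  obtains m' where "\<And>x. 0 \<le> m' x" "m' integrable_on {a..b}" "0 < integral {a..b} m'"
    "AE x\<in>{a<..<b} in lebesgue. m' x = m x"
proof -
  define p where "p x = max (m x) 0" for x
  have p: "p absolutely_integrable_on {a<..<b}"
    unfolding p_def by (rule absolutely_integrable_max_1[OF m(1)]) simp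
  have AEp: "AE x\<in>{a<..<b} in lebesgue. p x = m x" using m(2) by (auto simp: p_def)
  have int: "p integrable_on {a..b}"
    using p by (simp add: integrable_on_Icc_iff_Ioo set_lebesgue_integral_eq_integral(1))
  have "integral {a..b} p = (LINT x:{a<..<b}|lebesgue. p x)"
    using set_lebesgue_integral_eq_integral(2)[OF p] by (simp add: integral_open_interval_real)
  moreover have "(LINT x:{a<..<b}|lebesgue. p x) \<noteq> 0"
  proof
    assume "(LINT x:{a<..<b}|lebesgue. p x) = 0"
    then have "AE x in lebesgue. indicator {a<..<b} x *\<^sub>R p x = 0"
      unfolding set_lebesgue_integral_def
      using integral_nonneg_eq_0_iff_AE[OF p[unfolded set_integrable_def]] by (simp add: p_def)
    then have "AE x\<in>{a<..<b} in lebesgue. m x = 0" using AEp by eventually_elim auto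
    then show False using m(3) by blast
  qed
  moreover have "0 \<le> integral {a..b} p" by (rule integral_nonneg[OF int]) (simp add: p_def)
  ultimately show ?thesis by (intro that[of p]) (use int AEp in \<open>auto simp: p_def\<close>)
qed

text \<open>
  Near the boundary the trajectories may be arbitrarily small compared with their maximum, so the
  mass of a weight has to be found away from it.
\<close>

lemma integral_positive_inside:
  fixes m :: "real \<Rightarrow> real"
  assumes "a < b" and m: "m integrable_on {a..b}" and pos: "0 < integral {a..b} m"
  obtains d where "0 < d" "d \<le> (b - a) / 2" "0 < integral {a + d..b - d} m"
proof -
  let ?I = "\<lambda>x. integral {a..x} m"
  define G where "G d = ?I (b - d) - ?I (a + d)" for d
  have I: "continuous_on {a..b} ?I" by (rule indefinite_integral_continuous_1[OF m])
  have "continuous_on {0..(b - a)/2} G"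
    unfolding G_def[abs_def]
    by (intro continuous_intros continuous_on_compose2[OF I]) (use \<open>a < b\<close> in \<open>auto simp: field_simps\<close>)
  moreover have "0 \<in> {0..(b - a)/2}" "0 < G 0" using \<open>a < b\<close> pos by (auto simp: G_def)
  ultimately obtain \<delta> where \<delta>: "\<delta> > 0" "\<And>d. d \<in> {0..(b - a)/2} \<Longrightarrow> dist d 0 < \<delta> \<Longrightarrow> dist (G d) (G 0) < G 0"
    unfolding continuous_on_iff by metis
  define d where "d = min (\<delta>/2) ((b - a)/2)"
  have d: "0 < d" "d \<le> (b - a)/2" "d < \<delta>" using \<delta>(1) \<open>a < b\<close> unfolding d_def by (auto simp: min_def)
  have "0 < G d" using \<delta>(2)[of d] d by (auto simp: dist_real_def abs_if split: if_splits)
  moreover have "G d = integral {a + d..b - d} m"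
  proof -
    have "a \<le> a + d" "a + d \<le> b - d" using d by (auto simp: field_simps)
    moreover have "m integrable_on {a..b - d}" by (rule integrable_on_subinterval[OF m]) (use d in auto)
    ultimately show ?thesis
      using Henstock_Kurzweil_Integration.integral_combine[of a "a + d" "b - d" m] by (simp add: G_def)
  qed
  ultimately show ?thesis using that d by simp
qed

lemma solution_in_P_circ_cong_AE:
  assumes sol: "solution_in_P_circ a b \<phi> F u"
    and eq: "AE x\<in>{a<..<b} in lebesgue. F x (u x) = G x (u x)"
  shows "solution_in_P_circ a b \<phi> G u"
proof -
  have "AE x\<in>{a<..<b} in lebesgue.
        \<exists>d. ((\<lambda>y. \<phi> (deriv_on a b u y)) has_real_derivative d) (at x) \<and> - d = G x (u x)"
    using sol[unfolded solution_in_P_circ_def, THEN conjunct2, THEN conjunct2] eq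
    by eventually_elim auto
  then show ?thesis using sol unfolding solution_in_P_circ_def by blast
qed

lemma inverse_of_odd_homeomorphism:
  fixes \<phi> :: "real \<Rightarrow> real"
  assumes odd: "\<forall>x. \<phi> (- x) = - \<phi> x" and mono: "strict_mono \<phi>" and "\<exists>\<psi>. homeomorphism UNIV UNIV \<phi> \<psi>"
  obtains \<psi> where "continuous_on UNIV \<psi>" "strict_mono \<psi>" "\<psi> 0 = 0" "\<And>y. \<phi> (\<psi> y) = y" "\<And>x. \<psi> (\<phi> x) = x" "\<phi> 0 = 0"
proof -
  obtain \<psi> where h: "homeomorphism UNIV UNIV \<phi> \<psi>" using assms(3) by blast
  have 1: "\<And>y. \<phi> (\<psi> y) = y" "\<And>x. \<psi> (\<phi> x) = x" "continuous_on UNIV \<psi>"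
    using h unfolding homeomorphism_def by auto
  have "\<phi> (- 0) = - \<phi> 0" using odd by blast
  then have 0: "\<phi> 0 = 0" by simp
  have "strict_mono \<psi>" by (rule strict_monoI) (metis 1(1) mono strict_mono_less)
  moreover have "\<psi> 0 = 0" using 0 1(2) by metis
  ultimately show ?thesis using that 0 1 by blast
qed

lemma powr_dominates_near_zero:
  fixes \<phi> :: "real \<Rightarrow> real"
  assumes lim: "filterlim (\<lambda>t. t powr q / \<phi> t) at_top (at_right 0)" and pos: "\<And>t. 0 < t \<Longrightarrow> 0 < \<phi> t"
  obtains v where "0 < v" "\<And>t. 0 < t \<Longrightarrow> t < v \<Longrightarrow> Z * \<phi> t < t powr q"
proof -
  have "\<forall>\<^sub>F t in at_right 0. Z < t powr q / \<phi> t" using lim by (simp add: filterlim_at_top_dense)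
  then obtain v where "0 < v" "\<And>t. 0 < t \<Longrightarrow> t < v \<Longrightarrow> Z < t powr q / \<phi> t"
    unfolding eventually_at_right_field by blast
  then show ?thesis using pos that by (simp add: pos_less_divide_eq)
qed

lemma powr_dominates_near_infinity:
  fixes \<phi> :: "real \<Rightarrow> real"
  assumes lim: "filterlim (\<lambda>t. t powr r / \<phi> t) at_top at_top" and pos: "\<And>t. 0 < t \<Longrightarrow> 0 < \<phi> t"
  obtains v where "0 < v" "\<And>t. v < t \<Longrightarrow> Z * \<phi> t < t powr r"
proof -
  have "\<forall>\<^sub>F t in at_top. Z < t powr r / \<phi> t" using lim by (simp add: filterlim_at_top_dense)
  then obtain v where v: "\<And>t. v < t \<Longrightarrow> Z < t powr r / \<phi> t"
    unfolding eventually_at_top_dense by blast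
  show ?thesis
  proof (rule that[of "max v 1"])
    fix t assume "max v 1 < t"
    then show "Z * \<phi> t < t powr r" using v[of t] pos[of t] by (simp add: pos_less_divide_eq)
  qed simp
qed

lemma powr_dominated_near_zero:
  fixes \<phi> :: "real \<Rightarrow> real"
  assumes lim: "((\<lambda>t. t powr r / \<phi> t) \<longlongrightarrow> 0) (at_right 0)" and pos: "\<And>t. 0 < t \<Longrightarrow> 0 < \<phi> t"
    and "0 \<le> Z"
  obtains v where "0 < v" "\<And>t. 0 < t \<Longrightarrow> t < v \<Longrightarrow> Z * t powr r < \<phi> t"
proof -
  have "((\<lambda>t. Z * (t powr r / \<phi> t)) \<longlongrightarrow> 0) (at_right 0)"
    using tendsto_mult_left[OF lim, of Z] by simp
  then have "\<forall>\<^sub>F t in at_right 0. Z * (t powr r / \<phi> t) < 1" by (rule order_tendstoD) simp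
  then obtain v where "0 < v" "\<And>t. 0 < t \<Longrightarrow> t < v \<Longrightarrow> Z * (t powr r / \<phi> t) < 1"
    unfolding eventually_at_right_field by blast
  then show ?thesis using pos that by (simp add: pos_divide_less_eq)
qed

section \<open>Two solutions\<close>

theorem corollary1p2:
  fixes a b \<mu> :: real and \<phi> f g m n :: "real \<Rightarrow> real"
  assumes "a < b"
    and phi_odd: "\<forall>x. \<phi> (- x) = - \<phi> x"
    and phi_increasing: "strict_mono \<phi>"
    and phi_homeo: "\<exists>\<psi>. homeomorphism UNIV UNIV \<phi> \<psi>"
    and f: "continuous_on {0..} f" "\<forall>t\<ge>0. f t \<ge> 0"
    and g: "continuous_on {0..} g" "\<forall>t\<ge>0. g t \<ge> 0"
    and "\<mu> > 0"
    and m: "set_integrable lebesgue {a<..<b} m"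
           "AE x\<in>{a<..<b} in lebesgue. 0 \<le> m x"
           "\<not> (AE x\<in>{a<..<b} in lebesgue. m x = 0)"
    and n: "set_integrable lebesgue {a<..<b} n"
           "AE x\<in>{a<..<b} in lebesgue. 0 \<le> n x"
           "\<not> (AE x\<in>{a<..<b} in lebesgue. n x = 0)"
    and F: "\<exists>c\<^sub>0 t\<^sub>0 q. c\<^sub>0 > 0 \<and> t\<^sub>0 > 0 \<and> q > 0 \<and>
              (\<forall>t\<in>{0..t\<^sub>0}. f t \<ge> c\<^sub>0 * t powr q) \<and>
              filterlim (\<lambda>t. t powr q / \<phi> t) at_top (at_right 0)"
    and G1: "\<exists>c\<^sub>1 t\<^sub>1 r\<^sub>1. c\<^sub>1 > 0 \<and> t\<^sub>1 > 0 \<and> r\<^sub>1 > 0 \<and>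
              (\<forall>t\<in>{0..t\<^sub>1}. g t \<le> c\<^sub>1 * t powr r\<^sub>1) \<and>
              ((\<lambda>t. t powr r\<^sub>1 / \<phi> t) \<longlongrightarrow> 0) (at_right 0)"
    and G2: "\<exists>c\<^sub>2 t\<^sub>2 r\<^sub>2. c\<^sub>2 > 0 \<and> t\<^sub>2 > 0 \<and> r\<^sub>2 > 0 \<and>
              (\<forall>t\<ge>t\<^sub>2. g t \<ge> c\<^sub>2 * t powr r\<^sub>2) \<and>
              filterlim (\<lambda>t. t powr r\<^sub>2 / \<phi> t) at_top at_top"
  shows "\<exists>L>0. \<forall>l. 0 < l \<and> l < L \<longrightarrow>
           (\<exists>u v. solution_in_P_circ a b \<phi> (\<lambda>x s. l * m x * f s + \<mu> * n x * g s) u \<and>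
                  solution_in_P_circ a b \<phi> (\<lambda>x s. l * m x * f s + \<mu> * n x * g s) v \<and>
                  (\<exists>x\<in>{a..b}. u x \<noteq> v x))"
proof -
  obtain \<psi> where psi: "continuous_on UNIV \<psi>" "strict_mono \<psi>" "\<psi> 0 = 0"
    and phi_psi: "\<And>y. \<phi> (\<psi> y) = y" and psi_phi: "\<And>x. \<psi> (\<phi> x) = x" and phi_0: "\<phi> 0 = 0"
    using inverse_of_odd_homeomorphism[OF phi_odd phi_increasing phi_homeo] by blast
  have phi_pos: "0 < \<phi> t" if "0 < t" for t using strict_monoD[OF phi_increasing that] phi_0 by simp
  have odd: "\<And>y. \<phi> (- y) = - \<phi> y" using phi_odd by blast
  obtain m' where m': "m' integrable_on {a..b}" "\<And>x. 0 \<le> m' x" and mpos: "0 < integral {a..b} m'"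
    and m_eq: "AE x\<in>{a<..<b} in lebesgue. m' x = m x" by (rule nonneg_representative[OF m]) blast
  obtain n' where n': "n' integrable_on {a..b}" "\<And>x. 0 \<le> n' x" and npos: "0 < integral {a..b} n'"
    and n_eq: "AE x\<in>{a<..<b} in lebesgue. n' x = n x" by (rule nonneg_representative[OF n]) blast
  obtain c\<^sub>0 t\<^sub>0 q where c0: "0 < c\<^sub>0" "0 < t\<^sub>0" "0 < q" and f_low: "\<And>t. t \<in> {0..t\<^sub>0} \<Longrightarrow> c\<^sub>0 * t powr q \<le> f t"
    and f_lim: "filterlim (\<lambda>t. t powr q / \<phi> t) at_top (at_right 0)" using F by blast
  obtain c\<^sub>1 t\<^sub>1 r\<^sub>1 where c1: "0 < c\<^sub>1" "0 < t\<^sub>1" "0 < r\<^sub>1" and g_up: "\<And>t. t \<in> {0..t\<^sub>1} \<Longrightarrow> g t \<le> c\<^sub>1 * t powr r\<^sub>1"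
    and g_lim0: "((\<lambda>t. t powr r\<^sub>1 / \<phi> t) \<longlongrightarrow> 0) (at_right 0)" using G1 by blast
  obtain c\<^sub>2 t\<^sub>2 r\<^sub>2 where c2: "0 < c\<^sub>2" "0 < t\<^sub>2" "0 < r\<^sub>2" and g_low: "\<And>t. t \<ge> t\<^sub>2 \<Longrightarrow> c\<^sub>2 * t powr r\<^sub>2 \<le> g t"
    and g_lim: "filterlim (\<lambda>t. t powr r\<^sub>2 / \<phi> t) at_top at_top" using G2 by blast

  define M where "M = integral {a..b} m'"
  define N where "N = integral {a..b} n'"
  have MN: "0 < M" "0 < N" using mpos npos by (auto simp: M_def N_def)
  have Z: "0 \<le> 2 * (\<mu> * N * c\<^sub>1 * (b - a) powr r\<^sub>1)" using MN c1 \<open>0 < \<mu>\<close> by simp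
  obtain v1 where v1: "0 < v1"
    "\<And>t. 0 < t \<Longrightarrow> t < v1 \<Longrightarrow> 2 * (\<mu> * N * c\<^sub>1 * (b - a) powr r\<^sub>1) * t powr r\<^sub>1 < \<phi> t"
    by (rule powr_dominated_near_zero[OF g_lim0 phi_pos Z], assumption) (rule that)
  \<comment> \<open>The medium initial slope: trajectories stay below \<open>(b - a) * \<sigma>\<close>, where (G1) makes the \<open>g\<close> part of the drop less than \<open>\<phi> \<sigma> / 2\<close>.\<close>
  define \<sigma> where "\<sigma> = min (v1 / 2) (t\<^sub>1 / (b - a))"
  have \<sigma>: "0 < \<sigma>" "\<sigma> < v1" using v1(1) c1 \<open>a < b\<close> by (auto simp: \<sigma>_def)
  have "\<sigma> \<le> t\<^sub>1 / (b - a)" by (simp add: \<sigma>_def)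
  then have \<sigma>t1: "(b - a) * \<sigma> \<le> t\<^sub>1" using \<open>a < b\<close> by (simp add: field_simps)
  obtain C where C: "0 < C" "\<And>t. t \<in> {0..(b - a) * \<sigma>} \<Longrightarrow> f t \<le> C"
    using continuous_bounded_above_on_Icc[OF f(1)] by metis
  \<comment> \<open>For \<open>l < L\<close> the \<open>f\<close> part of the drop is less than \<open>\<phi> \<sigma> / 2\<close>, too.\<close>
  define L where "L = \<phi> \<sigma> / (2 * (M * C))"
  have "0 < L" using phi_pos[OF \<sigma>(1)] MN C by (simp add: L_def)
  show ?thesis
  proof (intro exI[of _ L] conjI allI impI)
    show "0 < L" by fact
    fix l assume l: "0 < l \<and> l < L"
    define H where "H z u = l * m' z * f (max 0 u) + \<mu> * n' z * g (max 0 u)" for z u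
    interpret shooting a b \<psi> H
      unfolding H_def[abs_def]
      by (rule shooting_separated) (use assms(1) psi f g m' n' l \<open>0 < \<mu>\<close> in auto)
    have fnn: "0 \<le> f (max 0 t)" and gnn: "0 \<le> g (max 0 t)" for t using f g by auto

    \<comment> \<open>The flux starts at \<open>\<phi> \<sigma>\<close> and cannot drop to zero, by the choice of \<open>\<sigma>\<close> and \<open>L\<close>.\<close>
    have middle: "0 < u b" if u: "exact (\<phi> \<sigma>) u" for u
    proof (rule exact_positive_end[OF phi_pos[OF \<sigma>(1)] _ _ _ u])
      let ?B = "c\<^sub>1 * ((b - a) * \<sigma>) powr r\<^sub>1"
      let ?h = "\<lambda>z. l * C * m' z + \<mu> * ?B * n' z"
      show "?h integrable_on {a..b}" by (intro integrable_add integrable_on_mult_right m' n')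
      have "integral {a..b} ?h = integral {a..b} (\<lambda>z. l * C * m' z) + integral {a..b} (\<lambda>z. \<mu> * ?B * n' z)"
        by (intro integral_add integrable_on_mult_right m' n')
      also have "\<dots> = l * (M * C) + \<mu> * N * c\<^sub>1 * (b - a) powr r\<^sub>1 * \<sigma> powr r\<^sub>1"
        by (simp add: M_def N_def powr_mult)
      also have "l * (M * C) < \<phi> \<sigma> / 2" using l MN C by (simp add: L_def field_simps)
      also have "\<mu> * N * c\<^sub>1 * (b - a) powr r\<^sub>1 * \<sigma> powr r\<^sub>1 < \<phi> \<sigma> / 2" using v1(2)[OF \<sigma>] by simp
      finally show "integral {a..b} ?h < \<phi> \<sigma>" by simp
      fix z u assume "u \<le> (b - a) * \<psi> (\<phi> \<sigma>)"
      then have u: "max 0 u \<in> {0..(b - a) * \<sigma>}" using \<sigma> \<open>a < b\<close> by (simp add: psi_phi)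
      then have "g (max 0 u) \<le> c\<^sub>1 * max 0 u powr r\<^sub>1" using \<sigma>t1 by (intro g_up) auto
      also have "\<dots> \<le> ?B" using u c1 by (intro mult_left_mono powr_mono2) auto
      finally have "g (max 0 u) \<le> ?B" .
      then have "\<mu> * n' z * g (max 0 u) \<le> \<mu> * n' z * ?B"
        using n'(2)[of z] \<open>0 < \<mu>\<close> by (intro mult_left_mono) auto
      moreover have "l * m' z * f (max 0 u) \<le> l * m' z * C"
        using C(2)[OF u] m'(2)[of z] l by (intro mult_left_mono) auto
      ultimately show "H z u \<le> ?h z" by (simp add: H_def algebra_simps)
    qed

    \<comment> \<open>A nonnegative end value would make the maximum positive but too small for (F).\<close>
    obtain \<sigma>' where \<sigma>': "0 < \<sigma>'" "\<sigma>' < \<sigma>" and small: "\<And>u. exact (\<phi> \<sigma>') u \<Longrightarrow> u b < 0"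
    proof -
      obtain d where d: "0 < d" "d \<le> (b - a) / 2" and W: "0 < integral {a + d..b - d} m'"
        by (rule integral_positive_inside[OF assms(1) m'(1) mpos]) blast
      define A where "A = integral {a + d..b - d} m' * (l * c\<^sub>0) * (d * d / (b - a)) powr q"
      have A: "0 < A" using W l c0 d \<open>a < b\<close> by (simp add: A_def)
      obtain v where v: "0 < v" "\<And>t. 0 < t \<Longrightarrow> t < v \<Longrightarrow> 2 / A * \<phi> t < t powr q"
        by (rule powr_dominates_near_zero[OF f_lim phi_pos], assumption) (rule that)
      \<comment> \<open>Below \<open>R\<close> the power bound on \<open>f\<close> holds, and \<open>u y / d\<close> is small enough for \<open>v\<close>.\<close>
      define R where "R = min t\<^sub>0 (d * v / 2)"
      have R: "0 < R" "R \<le> t\<^sub>0" "R < d * v" using c0 d v(1) by (auto simp: R_def min_def)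
      show thesis
      proof (rule that[of "min (\<sigma> / 2) (R / (b - a))"])
        let ?s = "min (\<sigma> / 2) (R / (b - a))"
        show s: "0 < ?s" "?s < \<sigma>" using \<sigma> R \<open>a < b\<close> by auto
        fix u assume u: "exact (\<phi> ?s) u"
        show "u b < 0"
        proof (rule ccontr)
          assume "\<not> u b < 0"
          then have ub: "0 \<le> u b" by simp
          obtain y where y: "y \<in> {a..b}" "\<And>x. x \<in> {a..b} \<Longrightarrow> u x \<le> u y" by (rule exact_max[OF u]) blast
          obtain x where "x \<in> {a<..<b}" "0 < u x" using exact_positive_somewhere[OF u phi_pos[OF s(1)]] by blast
          then have uy: "0 < u y" using y(2)[of x] by auto
          have "u y \<le> (b - a) * ?s"
            using exact_le[OF u less_imp_le[OF phi_pos[OF s(1)]] y(1)] by (simp only: psi_phi)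
          also have "\<dots> \<le> (b - a) * (R / (b - a))" using \<open>a < b\<close> by (intro mult_left_mono) auto
          finally have uR: "u y \<le> R" using \<open>a < b\<close> by simp
          have "A * (u y / d) powr q \<le> 2 * \<phi> (u y / d)"
            unfolding A_def
          proof (rule exact_power_drop[OF u ub phi_increasing phi_psi odd y uy d _ m'(2)])
            show "m' integrable_on {a + d..b - d}" by (rule integrable_on_subinterval[OF m'(1)]) (use d in auto)
            fix z t assume t: "d / (b - a) * u y \<le> t" "t \<le> u y"
            have t0: "0 \<le> t" using t(1) d uy \<open>a < b\<close> by (meson diff_gt_0_iff_gt divide_pos_pos mult_pos_pos order.strict_implies_order order.trans)
            have "l * m' z * (c\<^sub>0 * t powr q) \<le> l * m' z * f (max 0 t)"
              using f_low[of t] t t0 uR R(2) l m'(2)[of z] by (intro mult_left_mono) auto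
            moreover have "0 \<le> \<mu> * n' z * g (max 0 t)" using gnn n'(2)[of z] \<open>0 < \<mu>\<close> by simp
            ultimately show "m' z * (l * c\<^sub>0 * t powr q) \<le> H z t" by (simp add: H_def algebra_simps)
          qed (use l c0 in auto)
          moreover have "2 / A * \<phi> (u y / d) < (u y / d) powr q"
            by (rule v(2)) (use uy uR R(3) d in \<open>auto simp: field_simps\<close>)
          ultimately show False using A by (simp add: field_simps)
        qed
      qed
    qed

    \<comment> \<open>A nonnegative end value bounds the maximum by (G2), and thereby the initial flux.\<close>
    obtain S where large: "\<And>s u. S < s \<Longrightarrow> exact s u \<Longrightarrow> u b < 0"
    proof -
      obtain d where d: "0 < d" "d \<le> (b - a) / 2" and W: "0 < integral {a + d..b - d} n'"
        by (rule integral_positive_inside[OF assms(1) n'(1) npos]) blast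
      define A where "A = integral {a + d..b - d} n' * (\<mu> * c\<^sub>2) * (d * d / (b - a)) powr r\<^sub>2"
      have A: "0 < A" using W \<open>0 < \<mu>\<close> c2 d \<open>a < b\<close> by (simp add: A_def)
      obtain v where v: "0 < v" "\<And>t. v < t \<Longrightarrow> 2 / A * \<phi> t < t powr r\<^sub>2"
        by (rule powr_dominates_near_infinity[OF g_lim phi_pos], assumption) (rule that)
      \<comment> \<open>Above \<open>U\<close>, the lower bound \<open>d / (b - a) * u y\<close> exceeds \<open>t\<^sub>2\<close>, and \<open>u y / d\<close> is large enough for \<open>v\<close>.\<close>
      define U where "U = max (t\<^sub>2 * (b - a) / d) (d * v)"
      have U0: "0 < U" using d v(1) by (simp add: U_def less_max_iff_disj)
      have bound: "u x \<le> U" if u: "exact s u" "0 \<le> u b" and x: "x \<in> {a..b}" for s u x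
      proof -
        obtain y where y: "y \<in> {a..b}" "\<And>x. x \<in> {a..b} \<Longrightarrow> u x \<le> u y" by (rule exact_max[OF u(1)]) blast
        have "u y \<le> U"
        proof (rule ccontr)
          assume "\<not> u y \<le> U"
          then have uU: "U < u y" by simp
          then have uy: "0 < u y" using U0 by simp
          have "t\<^sub>2 * (b - a) / d < u y" "d * v < u y" using uU by (auto simp: U_def)
          then have big: "t\<^sub>2 < d / (b - a) * u y" "v < u y / d" using d \<open>a < b\<close> by (simp_all add: field_simps)
          have "A * (u y / d) powr r\<^sub>2 \<le> 2 * \<phi> (u y / d)"
            unfolding A_def
          proof (rule exact_power_drop[OF u phi_increasing phi_psi odd y uy d _ n'(2)])
            show "n' integrable_on {a + d..b - d}" by (rule integrable_on_subinterval[OF n'(1)]) (use d in auto)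
            fix z t assume t: "d / (b - a) * u y \<le> t" "t \<le> u y"
            then have "t\<^sub>2 \<le> t" using big by linarith
            then have "\<mu> * n' z * (c\<^sub>2 * t powr r\<^sub>2) \<le> \<mu> * n' z * g (max 0 t)"
              using g_low[of t] c2 \<open>0 < \<mu>\<close> n'(2)[of z] by (intro mult_left_mono) auto
            moreover have "0 \<le> l * m' z * f (max 0 t)" using fnn m'(2)[of z] l by simp
            ultimately show "n' z * (\<mu> * c\<^sub>2 * t powr r\<^sub>2) \<le> H z t" by (simp add: H_def algebra_simps)
          qed (use \<open>0 < \<mu>\<close> c2 in auto)
          moreover have "2 / A * \<phi> (u y / d) < (u y / d) powr r\<^sub>2" by (rule v(2)[OF big(2)])
          ultimately show False using A by (simp add: field_simps)
        qed
        then show ?thesis using y(2)[OF x] by simp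
      qed
      have "\<exists>S. \<forall>s u. S < s \<longrightarrow> exact s u \<longrightarrow> u b < 0"
        by (rule exact_negative_end_of_large_start[OF phi_increasing phi_psi]) (rule bound)
      then show thesis using that by blast
    qed

    have "\<phi> \<sigma>' \<le> \<phi> \<sigma>" using strict_monoD[OF phi_increasing \<sigma>'(2)] by simp
    then obtain s u where su: "s \<in> {\<phi> \<sigma>'..\<phi> \<sigma>}" "exact s u" "u b = 0"
      using exact_zero_between[of "\<phi> \<sigma>'" "\<phi> \<sigma>" 1] small middle by auto
    define T where "T = max (\<phi> \<sigma>) S + 1"
    have T: "\<phi> \<sigma> \<le> T" "S < T" unfolding T_def by linarith+
    then obtain s' v where sv: "s' \<in> {\<phi> \<sigma>..T}" "exact s' v" "v b = 0"
      using exact_zero_between[of "\<phi> \<sigma>" T "-1"] large middle by auto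
    \<comment> \<open>Each interval yields a solution; they differ since neither starts at the common end point.\<close>
    have "s \<noteq> \<phi> \<sigma>" "s' \<noteq> \<phi> \<sigma>" using middle su sv by force+
    then have "s < s'" using su(1) sv(1) by auto
    have pos: "0 < s" "0 < s'" using su(1) sv(1) phi_pos[OF \<sigma>(1)] phi_pos[OF \<sigma>'(1)] by auto
    let ?G = "\<lambda>x s. l * m x * f s + \<mu> * n x * g s"
    have sol: "solution_in_P_circ a b \<phi> ?G w" if w: "exact t w" "w b = 0" "0 < t" for t w
    proof -
      have sol: "solution_in_P_circ a b \<phi> H w" by (rule exact_solution_in_P_circ[OF w phi_psi])
      have wpos: "0 < w x" if "x \<in> {a<..<b}" for x
        using sol that unfolding solution_in_P_circ_def P_circ_def by blast
      show ?thesis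
      proof (rule solution_in_P_circ_cong_AE[OF sol])
        show "AE x\<in>{a<..<b} in lebesgue. H x (w x) = ?G x (w x)"
          using m_eq n_eq
        proof eventually_elim
          case (elim x)
          then show ?case using wpos[of x] by (auto simp: H_def max_def)
        qed
      qed
    qed
    have "\<not> (\<forall>x\<in>{a..b}. u x = v x)" using exact_inject[OF su(2) sv(2)] \<open>s < s'\<close> by blast
    then have "\<exists>x\<in>{a..b}. u x \<noteq> v x" by blast
    then show "\<exists>u v. solution_in_P_circ a b \<phi> ?G u \<and> solution_in_P_circ a b \<phi> ?G v \<and> (\<exists>x\<in>{a..b}. u x \<noteq> v x)"
      using sol[OF su(2,3) pos(1)] sol[OF sv(2,3) pos(2)] by blast
  qed
qed

end
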